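(* Let $\nu$ be a splitting law and let $(m_n)_{n\ge0}$ be a sequence of random compact triangulations, where $m_n$ has distribution $\mathbb U_n^\nu$. Then there exists a random compact space $m_\infty$ such that $m_n\to m_\infty$ as $n\to\infty$, where the convergence holds in distribution in the set of compact subspaces of the filled triangle $\tilde T$ equipped with the Hausdorff distance.
   Context: $A=(0,0)$, $B=(1,0)$, $C=e^{i\pi/3}$ in $\mathbb R^2\cong\mathbb C$; $T=[AB]\cup[BC]\cup[CA]$ and $\tilde T$ is the filled (closed) triangle. $V_2^*=\{x\in\mathbb R^3:x_i>0,\ x_1+x_2+x_3=1\}$. A splitting law is a probability distribution $\nu$ on $\mathbb R_+^3$ such that if $P=(P_1,P_2,P_3)\sim\nu$ then the law of $P$ is invariant under permutations of coordinates, $P_i>0$ a.s. for each $i$, and $P_1+P_2+P_3=1$ a.s. $\mathcal T^\infty=\bigcup_{n\ge0}\{1,2,3\}^n$. A ternary tree is a set $t\subseteq\mathcal T^\infty$ containing the empty word $\emptyset$, closed under removing the last letter, where each $u\in t$ has either none (leaf) or all three (internal node) of the children $u(1),u(2),u(3)$ in $t$. $t^0$ is the set of internal nodes, and $\mathcal T_n$ is the set of ternary trees with exactly $n$ internal nodes. Given $(P(u))_{u\in \mathcal T^\infty}$ with values in $V_2^*$, define for each $u$ an ordered triple of points: $(A_\emptyset,B_\emptyset,C_\emptyset)=(A,B,C)$; $M_u=P_1(u)A_u+P_2(u)B_u+P_3(u)C_u$; the triples of $u(1),u(2),u(3)$ are $(M_u,B_u,C_u)$, $(A_u,M_u,C_u)$,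 $(A_u,B_u,M_u)$. The compact triangulation associated with a finite ternary tree $t$ and $(P(u))_{u\in t^0}$ is $m=T\cup\bigcup_{u\in t^0}([A_uM_u]\cup[B_uM_u]\cup[C_uM_u])$. $\mathbb U_n^\nu$ is the distribution of the compact triangulation associated with $t_n$ and $(P(u))_{u\in t_n^0}$, where $t_n$ is uniform on $\mathcal T_n$ and $(P(u))_{u\in\mathcal T^\infty}$ are i.i.d. with law $\nu$, independent of $t_n$. *)

theory Defs
  imports "HOL-Probability.Probability"
begin

section \<open>The Hausdorff space of compact subsets of the filled triangle\<close>

definition ptA :: complex where "ptA = 0"
definition ptB :: complex where "ptB = 1"
definition ptC :: complex where "ptC = exp (\<i> * of_real (pi / 3))"

definition triangle_boundary :: "complex set"
  where "triangle_boundary =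
    closed_segment ptA ptB \<union> closed_segment ptB ptC \<union> closed_segment ptC ptA"

definition filled_triangle :: "complex set"
  where "filled_triangle = convex hull {ptA, ptB, ptC}"

definition hausdorff_distance :: "'a::metric_space set \<Rightarrow> 'a set \<Rightarrow> real"
  where "hausdorff_distance K L = max (SUP x\<in>K. infdist x L) (SUP y\<in>L. infdist y K)"

lemma SUP_infdist_le_iff:
  fixes K L :: "'a::metric_space set"
  assumes "compact K" "K \<noteq> {}"
  shows "(SUP x\<in>K. infdist x L) \<le> r \<longleftrightarrow> (\<forall>x\<in>K. infdist x L \<le> r)"
proof -
  have "compact ((\<lambda>x. infdist x L) ` K)"
    using assms by (intro compact_continuous_image continuous_intros)
  then have "bdd_above ((\<lambda>x. infdist x L) ` K)"
    by (intro bounded_imp_bdd_above compact_imp_bounded)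
  then show ?thesis
    using assms by (intro cSUP_le_iff)
qed

lemma infdist_le_iff_compact:
  fixes L :: "'a::metric_space set"
  assumes "compact L" "L \<noteq> {}"
  shows "infdist x L \<le> r \<longleftrightarrow> (\<exists>y\<in>L. dist x y \<le> r)"
proof
  assume "infdist x L \<le> r"
  moreover have "continuous_on L (dist x)"
    by (intro continuous_intros)
  then obtain y where "y \<in> L" "\<forall>z\<in>L. dist x y \<le> dist x z"
    using continuous_attains_inf[OF assms] by blast
  moreover from this have "dist x y \<le> infdist x L"
    using assms by (auto simp: infdist_notempty intro!: cINF_greatest)
  ultimately show "\<exists>y\<in>L. dist x y \<le> r" by force
qed (auto intro: infdist_le2)

lemma hausdorff_distance_le_iff:
  fixes K L :: "'a::metric_space set"
  assumes "compact K" "K \<noteq> {}" "compact L" "L \<noteq> {}"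
  shows "hausdorff_distance K L \<le> r \<longleftrightarrow>
    (\<forall>x\<in>K. \<exists>y\<in>L. dist x y \<le> r) \<and> (\<forall>y\<in>L. \<exists>x\<in>K. dist y x \<le> r)"
  using assms
  by (simp add: hausdorff_distance_def SUP_infdist_le_iff infdist_le_iff_compact)

text \<open>The Hausdorff distance is a (finite) metric on nonempty compact sets only, so the empty
  set is excluded.\<close>

typedef triangle_compact =
  "{K :: complex set. compact K \<and> K \<noteq> {} \<and> K \<subseteq> filled_triangle}"
  by (rule exI[of _ "{ptA}"]) (simp add: filled_triangle_def hull_inc)

setup_lifting type_definition_triangle_compact

instantiation triangle_compact :: metric_space
begin

lift_definition dist_triangle_compact :: "triangle_compact \<Rightarrow> triangle_compact \<Rightarrow> real"
  is hausdorff_distance .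

definition uniformity_triangle_compact :: "(triangle_compact \<times> triangle_compact) filter"
  where "uniformity_triangle_compact = (INF e\<in>{0<..}. principal {(x, y). dist x y < e})"

definition open_triangle_compact :: "triangle_compact set \<Rightarrow> bool"
  where "open_triangle_compact S =
    (\<forall>x\<in>S. \<forall>\<^sub>F (x', y) in uniformity. x' = x \<longrightarrow> y \<in> S)"

instance
proof
  fix K L M :: triangle_compact
  show "dist K L = 0 \<longleftrightarrow> K = L"
  proof transfer
    fix K L :: "complex set"
    assume K: "compact K \<and> K \<noteq> {} \<and> K \<subseteq> filled_triangle"
      and L: "compact L \<and> L \<noteq> {} \<and> L \<subseteq> filled_triangle"
    have le: "hausdorff_distance K L \<le> r \<longleftrightarrow>
        (\<forall>x\<in>K. \<exists>y\<in>L. dist x y \<le> r) \<and> (\<forall>y\<in>L. \<exists>x\<in>K. dist y x \<le> r)" for r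
      using K L by (intro hausdorff_distance_le_iff) auto
    obtain x where "x \<in> K" using K by auto
    then have "0 \<le> hausdorff_distance K L"
      using le[of "hausdorff_distance K L"] by (meson order_refl order_trans zero_le_dist)
    moreover have "hausdorff_distance K L \<le> 0 \<longleftrightarrow> K = L"
      unfolding le by auto
    ultimately show "hausdorff_distance K L = 0 \<longleftrightarrow> K = L" by auto
  qed
  show "dist K L \<le> dist K M + dist L M"
  proof transfer
    fix K L M :: "complex set"
    assume K: "compact K \<and> K \<noteq> {} \<and> K \<subseteq> filled_triangle"
      and L: "compact L \<and> L \<noteq> {} \<and> L \<subseteq> filled_triangle"
      and M: "compact M \<and> M \<noteq> {} \<and> M \<subseteq> filled_triangle"
    have KM: "(\<forall>x\<in>K. \<exists>z\<in>M. dist x z \<le> hausdorff_distance K M) \<and>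
        (\<forall>z\<in>M. \<exists>x\<in>K. dist z x \<le> hausdorff_distance K M)"
      using K M by (subst hausdorff_distance_le_iff[symmetric]) auto
    have LM: "(\<forall>x\<in>L. \<exists>z\<in>M. dist x z \<le> hausdorff_distance L M) \<and>
        (\<forall>z\<in>M. \<exists>x\<in>L. dist z x \<le> hausdorff_distance L M)"
      using L M by (subst hausdorff_distance_le_iff[symmetric]) auto
    have "\<exists>y\<in>L. dist x y \<le> hausdorff_distance K M + hausdorff_distance L M" if "x \<in> K" for x
    proof -
      obtain z where "z \<in> M" "dist x z \<le> hausdorff_distance K M" using KM \<open>x \<in> K\<close> by blast
      moreover obtain y where "y \<in> L" "dist z y \<le> hausdorff_distance L M"
        using LM \<open>z \<in> M\<close> by blast
      ultimately show ?thesis by (meson add_mono dist_triangle order_trans)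
    qed
    moreover have "\<exists>x\<in>K. dist y x \<le> hausdorff_distance K M + hausdorff_distance L M"
      if "y \<in> L" for y
    proof -
      obtain z where "z \<in> M" "dist y z \<le> hausdorff_distance L M" using LM \<open>y \<in> L\<close> by blast
      moreover obtain x where "x \<in> K" "dist z x \<le> hausdorff_distance K M"
        using KM \<open>z \<in> M\<close> by blast
      ultimately have "dist y x \<le> hausdorff_distance K M + hausdorff_distance L M"
        using dist_triangle[of y x z] by linarith
      with \<open>x \<in> K\<close> show ?thesis by blast
    qed
    ultimately show "hausdorff_distance K L \<le> hausdorff_distance K M + hausdorff_distance L M"
      using K L by (subst hausdorff_distance_le_iff) auto
  qed
qed (simp_all add: uniformity_triangle_compact_def open_triangle_compact_def)

end

section \<open>Convergence in distribution in a metric space\<close>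

definition converges_in_distribution ::
    "(nat \<Rightarrow> 'a measure) \<Rightarrow> (nat \<Rightarrow> 'a \<Rightarrow> 'c::metric_space) \<Rightarrow> 'b measure \<Rightarrow> ('b \<Rightarrow> 'c) \<Rightarrow> bool"
  where "converges_in_distribution M X N Y \<longleftrightarrow>
    (\<forall>f :: 'c \<Rightarrow> real. continuous_on UNIV f \<and> bounded (range f) \<longrightarrow>
      (\<lambda>n. \<integral>\<omega>. f (X n \<omega>) \<partial>M n) \<longlonglongrightarrow> (\<integral>\<omega>. f (Y \<omega>) \<partial>N))"

section \<open>Splitting laws\<close>

definition open_simplex :: "(real ^ 3) set"
  where "open_simplex = {x. (\<forall>i. 0 < x $ i) \<and> x $ 1 + x $ 2 + x $ 3 = 1}"

definition splitting_law :: "(real ^ 3) measure \<Rightarrow> bool"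
  where "splitting_law \<nu> \<longleftrightarrow>
    prob_space \<nu> \<and> sets \<nu> = sets borel \<and>
    (\<forall>\<sigma> :: 3 \<Rightarrow> 3. bij \<sigma> \<longrightarrow> distr \<nu> borel (\<lambda>p. \<chi> i. p $ \<sigma> i) = \<nu>) \<and>
    (\<forall>i. AE p in \<nu>. 0 < p $ i) \<and>
    (AE p in \<nu>. p $ 1 + p $ 2 + p $ 3 = 1)"

section \<open>Ternary trees\<close>

text \<open>Words over the alphabet \<open>{1, 2, 3}\<close> are lists over the numeral type \<open>3\<close>, whose elements
  are \<open>1\<close>, \<open>2\<close>, \<open>3\<close> (with \<open>3 = 0\<close>). The \<open>i\<close>-th child of \<open>u\<close> is \<open>u @ [i]\<close>.\<close>

definition ternary_tree :: "3 list set \<Rightarrow> bool"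
  where "ternary_tree t \<longleftrightarrow>
    [] \<in> t \<and> (\<forall>u i. u @ [i] \<in> t \<longrightarrow> u \<in> t) \<and>
    (\<forall>u\<in>t. (\<forall>i. u @ [i] \<notin> t) \<or> (\<forall>i. u @ [i] \<in> t))"

definition internal_nodes :: "3 list set \<Rightarrow> 3 list set"
  where "internal_nodes t = {u \<in> t. \<forall>i. u @ [i] \<in> t}"

definition ternary_trees :: "nat \<Rightarrow> 3 list set set"
  where "ternary_trees n =
    {t. ternary_tree t \<and> finite (internal_nodes t) \<and> card (internal_nodes t) = n}"

section \<open>Compact triangulations\<close>

definition barycentre :: "real ^ 3 \<Rightarrow> complex \<times> complex \<times> complex \<Rightarrow> complex"
  where "barycentre p = (\<lambda>(a, b, c). p $ 1 *\<^sub>R a + p $ 2 *\<^sub>R b + p $ 3 *\<^sub>R c)"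

definition subtriangle ::
    "3 \<Rightarrow> complex \<Rightarrow> complex \<times> complex \<times> complex \<Rightarrow> complex \<times> complex \<times> complex"
  where "subtriangle i M = (\<lambda>(a, b, c).
    if i = 1 then (M, b, c) else if i = 2 then (a, M, c) else (a, b, M))"

function triple :: "(3 list \<Rightarrow> real ^ 3) \<Rightarrow> 3 list \<Rightarrow> complex \<times> complex \<times> complex" where
  "triple P [] = (ptA, ptB, ptC)"
| "triple P (u @ [i]) = subtriangle i (barycentre (P u) (triple P u)) (triple P u)"
  by (auto, metis rev_exhaust)
termination by (relation "Wellfounded.measure (\<lambda>(P, u). length u)") auto

definition split_segments :: "(3 list \<Rightarrow> real ^ 3) \<Rightarrow> 3 list \<Rightarrow> complex set"
  where "split_segments P u = (case triple P u of (a, b, c) \<Rightarrow>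
    let M = barycentre (P u) (a, b, c) in
      closed_segment a M \<union> closed_segment b M \<union> closed_segment c M)"

definition triangulation_set :: "3 list set \<Rightarrow> (3 list \<Rightarrow> real ^ 3) \<Rightarrow> complex set"
  where "triangulation_set t P =
    triangle_boundary \<union> (\<Union>u\<in>internal_nodes t. split_segments P u)"

lemma barycentre_in_convex:
  assumes "p \<in> open_simplex" "convex S" "a \<in> S" "b \<in> S" "c \<in> S"
  shows "barycentre p (a, b, c) \<in> S"
proof -
  have "p $ 1 *\<^sub>R a + p $ 2 *\<^sub>R b + p $ 3 *\<^sub>R c \<in> convex hull {a, b, c}"
    using assms(1) unfolding convex_hull_3 open_simplex_def mem_Collect_eq
    by (intro exI[of _ "p $ 1"] exI[of _ "p $ 2"] exI[of _ "p $ 3"]) (auto intro: less_imp_le)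
  moreover have "convex hull {a, b, c} \<subseteq> S"
    using assms by (intro hull_minimal) auto
  ultimately show ?thesis by (auto simp: barycentre_def)
qed

lemma convex_filled_triangle: "convex filled_triangle"
  by (simp add: filled_triangle_def)

lemma vertices_in_filled_triangle:
  "ptA \<in> filled_triangle" "ptB \<in> filled_triangle" "ptC \<in> filled_triangle"
  by (auto simp: filled_triangle_def hull_inc)

lemma internal_nodes_butlast:
  assumes "ternary_tree t" "u @ [i] \<in> internal_nodes t"
  shows "u \<in> internal_nodes t"
  using assms unfolding ternary_tree_def internal_nodes_def by blast

lemma triple_in_filled_triangle:
  assumes "ternary_tree t" "\<forall>u\<in>internal_nodes t. P u \<in> open_simplex"
    and "u \<in> internal_nodes t" "triple P u = (a, b, c)"
  shows "{a, b, c} \<subseteq> filled_triangle"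
  using assms(3,4)
proof (induction u arbitrary: a b c rule: rev_induct)
  case Nil
  then show ?case using vertices_in_filled_triangle by auto
next
  case (snoc i u)
  obtain a' b' c' where tr: "triple P u = (a', b', c')" by (cases "triple P u")
  have u: "u \<in> internal_nodes t" using internal_nodes_butlast assms(1) snoc.prems(1) .
  have abc: "{a', b', c'} \<subseteq> filled_triangle" by (rule snoc.IH[OF u tr])
  have "barycentre (P u) (a', b', c') \<in> filled_triangle"
    using abc assms(2) u by (intro barycentre_in_convex convex_filled_triangle) auto
  with abc snoc.prems(2) show ?case
    by (auto simp: tr subtriangle_def split: if_splits)
qed

lemma triangle_boundary_subset: "triangle_boundary \<subseteq> filled_triangle"
  unfolding triangle_boundary_def
  by (intro Un_least closed_segment_subset convex_filled_triangle vertices_in_filled_triangle)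

lemma compact_triangle_boundary: "compact triangle_boundary"
  unfolding triangle_boundary_def by (intro compact_Un compact_segment)

lemma triangle_boundary_nonempty: "triangle_boundary \<noteq> {}"
  by (auto simp: triangle_boundary_def)

lemma compact_triangulation_set:
  assumes "finite (internal_nodes t)"
  shows "compact (triangulation_set t P)"
  unfolding triangulation_set_def
proof (intro compact_Un compact_triangle_boundary compact_UN assms)
  fix u
  show "compact (split_segments P u)"
    by (auto simp: split_segments_def Let_def split: prod.split intro!: compact_Un)
qed

lemma triangulation_set_subset:
  assumes "ternary_tree t" "\<forall>u\<in>internal_nodes t. P u \<in> open_simplex"
  shows "triangulation_set t P \<subseteq> filled_triangle"
proof -
  have "split_segments P u \<subseteq> filled_triangle" if u: "u \<in> internal_nodes t" for u
  proof -
    obtain a b c where tr: "triple P u = (a, b, c)" by (cases "triple P u")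
    have abc: "{a, b, c} \<subseteq> filled_triangle"
      by (rule triple_in_filled_triangle[OF assms u tr])
    moreover have "barycentre (P u) (a, b, c) \<in> filled_triangle"
      using abc assms(2) u by (intro barycentre_in_convex convex_filled_triangle) auto
    ultimately show ?thesis
      unfolding split_segments_def tr Let_def prod.case
      by (intro Un_least closed_segment_subset convex_filled_triangle) auto
  qed
  then show ?thesis
    using triangle_boundary_subset by (auto simp: triangulation_set_def)
qed

text \<open>The compact triangulation as a point of the Hausdorff space. The \<open>else\<close> branch is only
  reached on a null event, where some splitting vector is outside the open simplex, or for sets
  that are not finite ternary trees.\<close>

lift_definition compact_triangulation :: "3 list set \<Rightarrow> (3 list \<Rightarrow> real ^ 3) \<Rightarrow> triangle_compact"
  is "\<lambda>t P. if ternary_tree t \<and> finite (internal_nodes t) \<and>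
        (\<forall>u\<in>internal_nodes t. P u \<in> open_simplex)
      then triangulation_set t P else triangle_boundary"
  using compact_triangulation_set triangulation_set_subset
    compact_triangle_boundary triangle_boundary_subset triangle_boundary_nonempty
  by (auto simp: triangulation_set_def)

definition triangulation_law :: "(real ^ 3) measure \<Rightarrow> nat \<Rightarrow> triangle_compact measure"
  where "triangulation_law \<nu> n =
    distr (uniform_count_measure (ternary_trees n) \<Otimes>\<^sub>M (\<Pi>\<^sub>M u\<in>(UNIV :: 3 list set). \<nu>)) borel
      (\<lambda>(t, P). compact_triangulation t P)"

end

(* The uniform ternary tree with n internal nodes converges locally to an infinite tree with one
   infinite branch, the spine, whose i.i.d. steps are a uniform direction together with two
   independent critical Galton-Watson trees hanging off the spine.  Cutting the spine at height h
   changes the triangulation only inside the triangle T_h at the tip, hence by at most the perimeter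
   of T_h in Hausdorff distance, whatever tree sits there.  Averaged over the direction, a split
   multiplies the expected perimeter by at most 7/9 (by exchangeability each weight has mean 1/3), so
   the perimeter of T_h tends to 0 almost surely: the truncated triangulations of the infinite tree
   have an almost sure limit, and the finite triangulations share its law asymptotically. *)

theory Submission
  imports Defs "HOL-Real_Asymp.Real_Asymp"
begin

section \<open>Ternary trees as a datatype\<close>

text \<open>No mass is lost in the limit because of the weights. A step of the spine with
  \<open>k\<close> nodes (its own and those of its two side trees) has limiting frequency
  \<open>(4 / 27) ^ k\<close>, where 4/27 is the limit ratio of consecutive tree counts. At this
  critical value all finite trees together weigh 3/2, so the steps weigh 3 * (3/2)^2 * 4/27 = 1. The
  frequencies thus form a probability law on chains of each fixed length, and finitely many chains
  describe almost all large trees. Which branch of a finite tree is its spine is never decided: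
  grafting large trees onto short chains is injective, and counting the image is enough.

  Test functions are merely bounded and continuous, so a small Hausdorff distance gives no rate.
  Instead, the supremum of the change over all trees at the tip is integrated; it tends to 0 almost
  surely because all these triangulations approach one limit point.

  Expected perimeters are summed over all words of length \<open>h\<close> rather than followed
  along the spine: directions are independent of the splits, so the spine only averages this
  sum.\<close>

datatype ttree = Lf | Nd ttree ttree ttree

instance ttree :: countable
  by countable_datatype

primrec nint :: "ttree \<Rightarrow> nat" where
  "nint Lf = 0"
| "nint (Nd a b c) = Suc (nint a + nint b + nint c)"

primrec enc :: "ttree \<Rightarrow> 3 list set" where
  "enc Lf = {[]}"
| "enc (Nd a b c) = insert [] ((#) 1 ` enc a \<union> (#) 2 ` enc b \<union> (#) 3 ` enc c)"

primrec inod :: "ttree \<Rightarrow> 3 list set" where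
  "inod Lf = {}"
| "inod (Nd a b c) = insert [] ((#) 1 ` inod a \<union> (#) 2 ` inod b \<union> (#) 3 ` inod c)"

definition sub3 :: "3 \<Rightarrow> 'a \<Rightarrow> 'a \<Rightarrow> 'a \<Rightarrow> 'a" where
  "sub3 i a b c = (if i = 1 then a else if i = 2 then b else c)"

lemma distinct_3: "(1::3) \<noteq> 2" "(1::3) \<noteq> 3" "(2::3) \<noteq> 3" "(2::3) \<noteq> 1" "(3::3) \<noteq> 1" "(3::3) \<noteq> 2"
  by auto

lemma sub3_simps [simp]: "sub3 1 a b c = a" "sub3 2 a b c = b" "sub3 3 a b c = c"
  by (simp_all add: sub3_def)

lemma Cons_in_enc [simp]: "i # u \<in> enc (Nd a b c) \<longleftrightarrow> u \<in> enc (sub3 i a b c)"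
proof -
  consider "i = 1" | "i = 2" | "i = 3" using exhaust_3[of i] by blast
  then show ?thesis by cases (simp_all add: image_iff distinct_3)
qed

lemma Cons_in_inod [simp]: "i # u \<in> inod (Nd a b c) \<longleftrightarrow> u \<in> inod (sub3 i a b c)"
proof -
  consider "i = 1" | "i = 2" | "i = 3" using exhaust_3[of i] by blast
  then show ?thesis by cases (simp_all add: image_iff distinct_3)
qed

declare enc.simps(2) [simp del] inod.simps(2) [simp del]

lemma Nil_in_enc [simp]: "[] \<in> enc t"
  by (cases t) (auto simp: enc.simps(2))

lemma Nil_in_inod [simp]: "[] \<in> inod (Nd a b c)"
  by (auto simp: inod.simps(2))

lemma enc_prefix: "u @ [i] \<in> enc t \<Longrightarrow> u \<in> enc t"
proof (induction u arbitrary: t)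
  case (Cons j u)
  then show ?case by (cases t) auto
qed simp

lemma in_inod_iff: "u \<in> inod t \<longleftrightarrow> u \<in> enc t \<and> (\<forall>i. u @ [i] \<in> enc t)"
proof (induction u arbitrary: t)
  case Nil
  then show ?case by (cases t) auto
next
  case (Cons j u)
  then show ?case by (cases t) auto
qed

lemma enc_all_or_none: "u @ [i] \<in> enc t \<Longrightarrow> u @ [j] \<in> enc t"
proof (induction u arbitrary: t)
  case Nil
  then show ?case by (cases t) auto
next
  case (Cons k u)
  then show ?case by (cases t) auto
qed

lemma ternary_tree_enc: "ternary_tree (enc t)"
  unfolding ternary_tree_def by (simp, metis enc_prefix enc_all_or_none)

lemma internal_nodes_enc [simp]: "internal_nodes (enc t) = inod t"
  by (auto simp: internal_nodes_def in_inod_iff)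

lemma finite_inod [simp]: "finite (inod t)"
  by (induction t) (auto simp: inod.simps(2))

lemma card_inod: "card (inod t) = nint t"
proof (induction t)
  case (Nd a b c)
  have "card (inod (Nd a b c)) = Suc (card ((#) 1 ` inod a \<union> (#) 2 ` inod b \<union> (#) 3 ` inod c))"
    unfolding inod.simps(2) by (subst card_insert_disjoint) auto
  also have "card ((#) 1 ` inod a \<union> (#) 2 ` inod b \<union> (#) 3 ` inod c)
      = card ((#) 1 ` inod a) + card ((#) 2 ` inod b) + card ((#) 3 ` inod c)"
    by (subst card_Un_disjoint, auto)+
  also have "\<dots> = nint a + nint b + nint c"
    using Nd by (simp add: card_image)
  finally show ?case by simp
qed simp

lemma inj_enc: "inj enc"
proof (rule injI)
  show "enc s = enc t \<Longrightarrow> s = t" for s t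
  proof (induction s arbitrary: t)
    case Lf
    have "[1] \<in> enc (Nd a b c)" for a b c by simp
    with Lf show ?case by (cases t) (auto simp del: Cons_in_enc)
  next
    case (Nd a b c)
    have "[1] \<in> enc t" using Nd.prems[symmetric] by simp
    then obtain a' b' c' where t: "t = Nd a' b' c'" by (cases t) auto
    have "enc (sub3 i a b c) = enc (sub3 i a' b' c')" for i
      using Nd.prems unfolding t by (metis Cons_in_enc set_eqI)
    from this[of 1] this[of 2] this[of 3] show ?case
      using Nd.IH t by simp
  qed
qed

lemma ternary_tree_Nil: "ternary_tree T \<Longrightarrow> [] \<in> T"
  by (simp add: ternary_tree_def)

lemma ternary_tree_prefix: "ternary_tree T \<Longrightarrow> u @ v \<in> T \<Longrightarrow> u \<in> T"
proof (induction v rule: rev_induct)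
  case (snoc i v)
  then show ?case unfolding ternary_tree_def by (metis append_assoc)
qed simp

text \<open>Ternary trees are defined by removing last letters, whereas the datatype splits at the
  first letter. The words behind a first letter \<open>i\<close> again form a ternary tree, and its
  internal nodes inject into those of \<open>T\<close> other than the root, so the recursion
  ends.\<close>

lemma enc_surj:
  assumes "ternary_tree T" "finite (internal_nodes T)"
  shows "\<exists>t. enc t = T"
  using assms
proof (induction "card (internal_nodes T)" arbitrary: T rule: less_induct)
  case (less T)
  show ?case
  proof (cases "[] \<in> internal_nodes T")
    case False
    then have no: "[i] \<notin> T" for i
    proof -
      have T: "[] \<in> T" using less.prems(1) by (rule ternary_tree_Nil)
      then have "(\<forall>i. [] @ [i] \<notin> T) \<or> (\<forall>i. [] @ [i] \<in> T)"
        using less.prems(1) unfolding ternary_tree_def by blast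
      moreover have "\<not> (\<forall>i. [] @ [i] \<in> T)" using False T by (simp add: internal_nodes_def)
      ultimately show ?thesis by (metis append_Nil)
    qed
    have "T = {[]}"
    proof (intro equalityI subsetI)
      fix u assume u: "u \<in> T"
      show "u \<in> {[]}"
      proof (cases u)
        case (Cons i v)
        then show ?thesis using ternary_tree_prefix[OF less.prems(1), of "[i]" v] u no by simp
      qed simp
    qed (simp add: ternary_tree_Nil less.prems(1))
    then show ?thesis by (intro exI[of _ Lf]) simp
  next
    case True
    define S where "S i = {u. i # u \<in> T}" for i :: 3
    have S: "ternary_tree (S i)" for i
      unfolding ternary_tree_def
    proof (intro conjI allI ballI impI)
      show "[] \<in> S i" using True by (auto simp: S_def internal_nodes_def)
      show "u \<in> S i" if "u @ [j] \<in> S i" for u j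
        using that ternary_tree_prefix[OF less.prems(1), of "i # u" "[j]"] by (auto simp: S_def)
      show "(\<forall>j. u @ [j] \<notin> S i) \<or> (\<forall>j. u @ [j] \<in> S i)" if "u \<in> S i" for u
      proof -
        have "(\<forall>j. (i # u) @ [j] \<notin> T) \<or> (\<forall>j. (i # u) @ [j] \<in> T)"
          using that less.prems(1) unfolding ternary_tree_def S_def by blast
        then show ?thesis by (simp add: S_def)
      qed
    qed
    have int: "(#) i ` internal_nodes (S i) \<subseteq> internal_nodes T - {[]}" for i
      by (auto simp: internal_nodes_def S_def)
    have fin: "finite (internal_nodes (S i))" for i
      using finite_subset[OF int, of i] less.prems(2) finite_imageD[of "(#) i" "internal_nodes (S i)"]
      by simp
    have "card (internal_nodes (S i)) < card (internal_nodes T)" for i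
    proof -
      have "card (internal_nodes (S i)) = card ((#) i ` internal_nodes (S i))"
        by (simp add: card_image)
      also have "\<dots> \<le> card (internal_nodes T - {[]})"
        using int less.prems(2) by (intro card_mono) auto
      also have "\<dots> < card (internal_nodes T)"
        using True less.prems(2) by (intro card_Diff1_less)
      finally show ?thesis .
    qed
    then have "\<exists>t. enc t = S i" for i
      using less.hyps[OF _ S fin, of i] by simp
    then have "\<forall>i. \<exists>t. enc t = S i" by blast
    then obtain t where t: "\<And>i. enc (t i) = S i" by metis
    have "enc (Nd (t 1) (t 2) (t 3)) = T"
    proof (rule set_eqI)
      fix u
      show "u \<in> enc (Nd (t 1) (t 2) (t 3)) \<longleftrightarrow> u \<in> T"
      proof (cases u)
        case Nil
        then show ?thesis using True by (simp add: internal_nodes_def)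
      next
        case (Cons i v)
        have "sub3 i (t 1) (t 2) (t 3) = t i" using exhaust_3[of i] by auto
        then show ?thesis by (simp add: Cons t S_def)
      qed
    qed
    then show ?thesis by blast
  qed
qed

definition trees :: "nat \<Rightarrow> ttree set" where
  "trees n = {t. nint t = n}"

lemma bij_betw_enc: "bij_betw enc (trees n) (ternary_trees n)"
  unfolding bij_betw_def
proof
  show "inj_on enc (trees n)" using inj_enc by (rule inj_on_subset) simp
  show "enc ` trees n = ternary_trees n"
  proof (intro equalityI subsetI)
    fix T assume T: "T \<in> ternary_trees n"
    then obtain t where "enc t = T" using enc_surj by (auto simp: ternary_trees_def)
    then show "T \<in> enc ` trees n"
      using T card_inod[of t] by (auto simp: ternary_trees_def trees_def)
  qed (auto simp: trees_def ternary_trees_def ternary_tree_enc card_inod)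
qed

section \<open>Counting ternary trees\<close>

text \<open>Ordered forests are counted instead of single trees because opening the first root gives
  a linear recurrence: a leaf is deleted, a node is replaced by its three subtrees. For single trees
  the recurrence would be a threefold convolution.\<close>

definition forests :: "nat \<Rightarrow> nat \<Rightarrow> ttree list set" where
  "forests k n = {xs. length xs = k \<and> sum_list (map nint xs) = n}"

lemma forests_Suc_0: "forests (Suc k) 0 = (#) Lf ` forests k 0"
proof (intro equalityI subsetI)
  fix xs assume "xs \<in> forests (Suc k) 0"
  then obtain x ys where "xs = x # ys" "nint x = 0" "ys \<in> forests k 0"
    by (auto simp: forests_def length_Suc_conv)
  then show "xs \<in> (#) Lf ` forests k 0" by (cases x) auto
qed (auto simp: forests_def)

text \<open>The inverse of opening a root. It is meaningful on lists with at least three entries,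
  which \<open>forests (k + 3) n\<close> guarantees.\<close>

definition join3 :: "ttree list \<Rightarrow> ttree list" where
  "join3 xs = Nd (xs ! 0) (xs ! 1) (xs ! 2) # drop 3 xs"

lemma join3_simp [simp]: "join3 (a # b # c # xs) = Nd a b c # xs"
  by (simp add: join3_def numeral_2_eq_2 numeral_3_eq_3)

lemma forests_add_3:
  "xs \<in> forests (k + 3) n \<longleftrightarrow>
    (\<exists>a b c ys. xs = a # b # c # ys \<and> length ys = k \<and> nint a + nint b + nint c + sum_list (map nint ys) = n)"
  by (auto simp: forests_def numeral_3_eq_3 length_Suc_conv)

lemma forests_Suc_Suc:
  "forests (Suc k) (Suc n) = (#) Lf ` forests k (Suc n) \<union> join3 ` forests (k + 3) n"
proof (intro equalityI subsetI)
  fix xs assume "xs \<in> forests (Suc k) (Suc n)"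
  then obtain x ys where xs: "xs = x # ys" "nint x + sum_list (map nint ys) = Suc n" "length ys = k"
    by (auto simp: forests_def length_Suc_conv)
  show "xs \<in> (#) Lf ` forests k (Suc n) \<union> join3 ` forests (k + 3) n"
  proof (cases x)
    case Lf
    then show ?thesis using xs by (auto simp: forests_def)
  next
    case (Nd a b c)
    then have "a # b # c # ys \<in> forests (k + 3) n" using xs by (auto simp: forests_add_3)
    moreover have "xs = join3 (a # b # c # ys)" using xs Nd by simp
    ultimately show ?thesis by blast
  qed
next
  fix xs assume "xs \<in> (#) Lf ` forests k (Suc n) \<union> join3 ` forests (k + 3) n"
  then show "xs \<in> forests (Suc k) (Suc n)"
  proof
    assume "xs \<in> join3 ` forests (k + 3) n"
    then obtain ys where "ys \<in> forests (k + 3) n" "xs = join3 ys" by blast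
    then show ?thesis unfolding forests_add_3 by (auto simp: forests_def)
  qed (auto simp: forests_def)
qed

lemma inj_on_join3: "inj_on join3 (forests (k + 3) n)"
proof (rule inj_onI)
  fix xs ys assume "xs \<in> forests (k + 3) n" "ys \<in> forests (k + 3) n" and eq: "join3 xs = join3 ys"
  then obtain a b c xs' a' b' c' ys' where "xs = a # b # c # xs'" "ys = a' # b' # c' # ys'"
    unfolding forests_add_3 by blast
  then show "xs = ys" using eq by simp
qed

text \<open>Multiplied by \<open>3 n + k\<close>, since the closed form \<open>k / (3 n + k) * (3 n + k choose n)\<close> fails at
  \<open>k = n = 0\<close>, where division yields \<open>0\<close>.\<close>

lemma forests_count:
  "finite (forests k n) \<and> (3 * n + k) * card (forests k n) = k * ((3 * n + k) choose n)"
proof (induction n arbitrary: k)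
  case 0
  show ?case
  proof (induction k)
    case 0
    have "forests 0 0 = {[]}" by (auto simp: forests_def)
    then show ?case by simp
  next
    case (Suc k)
    have "card (forests j 0) = 1 \<and> finite (forests j 0)" for j
    proof (induction j)
      case 0
      have "forests 0 0 = {[]}" by (auto simp: forests_def)
      then show ?case by simp
    qed (simp add: forests_Suc_0 card_image)
    then show ?case by simp
  qed
next
  case (Suc n)
  note IH = Suc
  show ?case
  proof (induction k)
    case 0
    have "forests 0 (Suc n) = {}" by (auto simp: forests_def)
    then show ?case by simp
  next
    case (Suc k)
    \<comment> \<open>Deleting a leaf lowers \<open>k\<close> by one, while opening a node lowers
      \<open>n\<close> by one and raises the number of trees by two. Either way
      \<open>3 n + k\<close> drops by one, so both summands share the upper entry \<open>N\<close>,
      one below that of the claim.\<close>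
    define N where "N = 3 * n + k + 3"
    define F1 where "F1 = card (forests k (Suc n))"
    define F2 where "F2 = card (forests (k + 3) n)"
    have fin: "finite (forests (Suc k) (Suc n))"
      using Suc IH by (simp add: forests_Suc_Suc)
    have "card (forests (Suc k) (Suc n)) = card ((#) Lf ` forests k (Suc n)) + card (join3 ` forests (k + 3) n)"
      unfolding forests_Suc_Suc
    proof (rule card_Un_disjoint)
      show "(#) Lf ` forests k (Suc n) \<inter> join3 ` forests (k + 3) n = {}"
        by (auto simp: join3_def)
    qed (use Suc IH in auto)
    then have F: "card (forests (Suc k) (Suc n)) = F1 + F2"
      by (simp add: card_image inj_on_join3 F1_def F2_def)
    have 1: "int N * int F1 = int k * int (N choose Suc n)"
      using Suc by (simp add: F1_def N_def algebra_simps flip: of_nat_mult of_nat_add)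
    have 2: "int N * int F2 = (int k + 3) * int (N choose n)"
      using IH[of "k + 3"] by (simp add: F2_def N_def algebra_simps flip: of_nat_mult of_nat_add)
    have "int (Suc N * (N choose n)) = int (((N choose n) + (N choose Suc n)) * Suc n)"
      using Suc_times_binomial_eq[of N n] by simp
    then have 3: "(int n + 1) * int (N choose Suc n) = (int N - int n) * int (N choose n)"
      by (simp only: of_nat_mult of_nat_add of_nat_Suc) algebra
    have N: "int N = 3 * (int n + 1) + int k" by (simp add: N_def)
    \<comment> \<open>\<open>F1\<close> and \<open>F2\<close> are known only after multiplication by
      \<open>N\<close>, so the claim is proved times \<open>N\<close>, which is then cancelled.
      Pascal's rule recombines the two binomials.\<close>
    have "int N * ((int N + 1) * (int F1 + int F2) - (int k + 1) * (int (N choose n) + int (N choose Suc n))) = 0"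
      using 1 2 3 unfolding N by algebra
    then have "(int N + 1) * (int F1 + int F2) = (int k + 1) * (int (N choose n) + int (N choose Suc n))"
      using N by simp
    then have "int ((N + 1) * (F1 + F2)) = int ((k + 1) * ((N + 1) choose (Suc n)))"
      by (simp add: algebra_simps)
    then have "(N + 1) * (F1 + F2) = (k + 1) * ((N + 1) choose (Suc n))"
      by (simp only: of_nat_eq_iff)
    moreover have eq: "3 * Suc n + Suc k = N + 1" by (simp add: N_def)
    ultimately show ?case unfolding eq F using fin by simp
  qed
qed

section \<open>Asymptotics of the number of ternary trees\<close>

lemma trees_forests: "bij_betw (\<lambda>t. [t]) (trees n) (forests 1 n)"
  unfolding bij_betw_def by (auto simp: inj_on_def trees_def forests_def length_Suc_conv image_iff)

lemma finite_trees [simp]: "finite (trees n)"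
  using bij_betw_finite[OF trees_forests] forests_count by blast

text \<open>The case \<open>k = 1\<close> of the forest count: the Fuss-Catalan numbers. In
  factorial form the ratio of consecutive terms is a rational function of \<open>n\<close>.\<close>

lemma card_trees: "real (card (trees n)) = fact (3 * n) / (fact n * fact (2 * n + 1))"
proof -
  have "card (trees n) = card (forests 1 n)"
    using trees_forests by (rule bij_betw_same_card)
  then have "(3 * n + 1) * card (trees n) = (3 * n + 1) choose n"
    using forests_count[of 1 n] by simp
  then have "real (3 * n + 1) * real (card (trees n)) = real ((3 * n + 1) choose n)"
    by (metis of_nat_mult)
  also have "\<dots> = fact (3 * n + 1) / (fact n * fact (3 * n + 1 - n))"
    by (rule binomial_fact) simp
  also have "3 * n + 1 - n = 2 * n + 1" by simp
  also have "(fact (3 * n + 1) :: real) = real (3 * n + 1) * fact (3 * n)"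
    by (simp add: algebra_simps)
  finally have "real (3 * n + 1) * real (card (trees n)) =
    real (3 * n + 1) * (fact (3 * n) / (fact n * fact (2 * n + 1)))"
    by (simp only: times_divide_eq_right)
  moreover have "real (3 * n + 1) \<noteq> 0" by (simp only: of_nat_eq_0_iff)
  ultimately show ?thesis by (simp only: mult_cancel_left) blast
qed

lemma card_trees_pos: "0 < card (trees n)"
proof -
  have "0 < real (card (trees n))" unfolding card_trees by simp
  then show ?thesis by simp
qed

lemma trees_nonempty [simp]: "trees n \<noteq> {}"
  using card_trees_pos[of n] by auto

lemma card_trees_Suc:
  "real (card (trees n)) * ((3 * real n + 3) * (3 * real n + 2) * (3 * real n + 1)) =
    real (card (trees (Suc n))) * ((real n + 1) * (2 * real n + 3) * (2 * real n + 2))"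
proof -
  define x where "x = real n"
  have f1: "fact (3 * Suc n) = (3 * x + 3) * ((3 * x + 2) * ((3 * x + 1) * fact (3 * n)))"
  proof -
    have "3 * Suc n = Suc (Suc (Suc (3 * n)))" by simp
    then show ?thesis by (simp only: fact_Suc) (simp add: x_def algebra_simps)
  qed
  have f2: "fact (Suc n) = (x + 1) * fact n"
    by (simp add: x_def)
  have f3: "fact (2 * Suc n + 1) = (2 * x + 3) * ((2 * x + 2) * fact (2 * n + 1))"
    by (simp add: x_def fact_reduce[of "2 * Suc n + 1"] algebra_simps)
  have "x \<ge> 0" by (simp add: x_def)
  then have "x + 1 \<noteq> 0" "2 * x + 3 \<noteq> 0" "2 * x + 2 \<noteq> 0" by linarith+
  then show ?thesis
    unfolding card_trees f1 f2 f3 x_def[symmetric]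
    by (simp add: divide_simps del: fact_Suc)
qed

text \<open>The constant 4/27 originates here, as the quotient of the leading coefficients 1 * 2 * 2
  and 3 * 3 * 3.\<close>

lemma card_trees_ratio: "(\<lambda>n. real (card (trees n)) / real (card (trees (Suc n)))) \<longlonglongrightarrow> 4 / 27"
proof -
  have "real (card (trees n)) / real (card (trees (Suc n))) =
      ((real n + 1) * (2 * real n + 3) * (2 * real n + 2)) / ((3 * real n + 3) * (3 * real n + 2) * (3 * real n + 1))" for n
  proof (subst frac_eq_eq)
    show "(3 * real n + 3) * (3 * real n + 2) * (3 * real n + 1) \<noteq> 0"
      by (simp add: add_nonneg_eq_0_iff)
  qed (use card_trees_Suc[of n] card_trees_pos[of "Suc n"] in \<open>auto simp: mult.commute\<close>)
  moreover have "(\<lambda>n. ((real n + 1) * (2 * real n + 3) * (2 * real n + 2)) / ((3 * real n + 3) * (3 * real n + 2) * (3 * real n + 1))) \<longlonglongrightarrow> 4 / 27"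
    by real_asymp
  ultimately show ?thesis by simp
qed

text \<open>A tree of size \<open>n\<close> that starts with steps of total size \<open>k\<close>
  has a tip with \<open>n - k\<close> nodes, so this will be the limiting frequency of such steps.
  The truncated subtraction affects only finitely many \<open>n\<close>.\<close>

lemma card_trees_ratio_shift:
  "(\<lambda>n. real (card (trees (n - k))) / real (card (trees n))) \<longlonglongrightarrow> (4 / 27) ^ k"
proof -
  have "(\<lambda>n. real (card (trees n)) / real (card (trees (n + k)))) \<longlonglongrightarrow> (4 / 27) ^ k"
  proof (induction k)
    case 0
    then show ?case by simp
  next
    case (Suc k)
    have "(\<lambda>n. real (card (trees (n + k))) / real (card (trees (Suc (n + k))))) \<longlonglongrightarrow> 4 / 27"
      using LIMSEQ_ignore_initial_segment[OF card_trees_ratio, of k] by simp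
    from tendsto_mult[OF this Suc] show ?case by simp
  qed
  note lim = this
  show ?thesis
    by (rule LIMSEQ_offset[where k = k]) (simp add: lim)
qed

section \<open>Grafting along a spine\<close>

type_synonym step = "3 \<times> ttree \<times> ttree"

definition node3 :: "3 \<Rightarrow> ttree \<Rightarrow> ttree \<Rightarrow> ttree \<Rightarrow> ttree" where
  "node3 i a b c = sub3 i (Nd c a b) (Nd a c b) (Nd a b c)"

primrec graft :: "step list \<Rightarrow> ttree \<Rightarrow> ttree" where
  "graft [] t = t"
| "graft (x # xs) t = node3 (fst x) (fst (snd x)) (snd (snd x)) (graft xs t)"

definition step_size :: "step \<Rightarrow> nat" where
  "step_size x = Suc (nint (fst (snd x)) + nint (snd (snd x)))"

definition steps_size :: "step list \<Rightarrow> nat" where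
  "steps_size xs = sum_list (map step_size xs)"

lemma nint_graft [simp]: "nint (graft s t) = steps_size s + nint t"
  by (induction s) (auto simp: node3_def steps_size_def step_size_def sub3_def)

text \<open>A child with more than \<open>K\<close> nodes cannot be one of the two small ones, so
  its position reveals the direction.\<close>

lemma node3_eqD:
  assumes "node3 i a b c = node3 j a' b' c'" "nint a \<le> K" "nint b \<le> K" "nint a' \<le> K" "nint b' \<le> K"
    "K < nint c" "K < nint c'"
  shows "i = j \<and> a = a' \<and> b = b' \<and> c = c'"
  using exhaust_3[of i] exhaust_3[of j] assms(1)
  by (elim disjE) (use assms(2-7) in \<open>auto simp: node3_def\<close>)

text \<open>Every remaining part of the spine still carries the large tree at its tip. At each
  vertex the spine therefore continues into the only child with more than \<open>K\<close> nodes,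
  and the steps can be read off one by one.\<close>

lemma graft_inj:
  assumes "graft s t = graft s' t'" "length s = length s'"
    "steps_size s \<le> K" "steps_size s' \<le> K" "K < nint t" "K < nint t'"
  shows "s = s' \<and> t = t'"
  using assms
proof (induction s s' rule: list_induct2'[consumes 0, case_names a b c d])
  case (d x s x' s')
  have "fst x = fst x' \<and> fst (snd x) = fst (snd x') \<and> snd (snd x) = snd (snd x') \<and> graft s t = graft s' t'"
    using d.prems by (intro node3_eqD[of _ _ _ _ _ _ _ _ K]) (auto simp: steps_size_def step_size_def)
  moreover from this have "s = s' \<and> t = t'"
    using d.prems by (intro d.IH) (auto simp: steps_size_def)
  ultimately show ?case by (simp add: prod_eq_iff)
qed auto

text \<open>A functional that is nearly determined by the steps of a spine has convergent averages over
  the trees of size \<open>n\<close>: the proportion of these trees that start with the steps \<open>s\<close> tends to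
  \<open>(4 / 27) ^ steps_size s\<close>, because for large \<open>n\<close> the tip of the spine carries the only large
  subtree and so is determined by the tree.\<close>

lemma uniform_tree_average_tendsto:
  fixes \<phi> :: "ttree \<Rightarrow> real"
  assumes B: "\<And>t. \<bar>\<phi> t\<bar> \<le> B"
    and approx: "\<And>\<epsilon>. 0 < \<epsilon> \<Longrightarrow> \<exists>h S l e. finite S \<and> (\<forall>s\<in>S. length s = h) \<and>
      1 - \<epsilon> \<le> (\<Sum>s\<in>S. (4 / 27) ^ steps_size s) \<and>
      (\<forall>s\<in>S. \<forall>t. \<bar>\<phi> (graft s t) - l s\<bar> \<le> e s) \<and>
      (\<Sum>s\<in>S. (4 / 27) ^ steps_size s * e s) \<le> \<epsilon> \<and>
      \<bar>(\<Sum>s\<in>S. (4 / 27) ^ steps_size s * l s) - L\<bar> \<le> \<epsilon>"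
  shows "(\<lambda>n. (\<Sum>t\<in>trees n. \<phi> t) / real (card (trees n))) \<longlonglongrightarrow> L"
proof (rule LIMSEQ_I)
  fix r :: real assume r: "0 < r"
  have B0: "0 \<le> B" using B[of Lf] by linarith
  \<comment> \<open>The bound \<open>R\<close> below adds \<open>B\<close> times the frequency of
    trees missed by \<open>S\<close>, the mean of \<open>e\<close>, and the error of the mean of
    \<open>l\<close>. Its limit is at most \<open>(B + 2) * \<epsilon>\<close>, so one further
    \<epsilon> makes the inequality strict.\<close>
  define \<epsilon> where "\<epsilon> = r / (B + 3)"
  have \<epsilon>: "0 < \<epsilon>" "(B + 3) * \<epsilon> = r" using r B0 by (auto simp: \<epsilon>_def)
  from approx[OF \<epsilon>(1)] obtain h S l e where S: "finite S" and len: "\<And>s. s \<in> S \<Longrightarrow> length s = h"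
    and q: "1 - \<epsilon> \<le> (\<Sum>s\<in>S. (4 / 27) ^ steps_size s)"
    and le: "\<And>s t. s \<in> S \<Longrightarrow> \<bar>\<phi> (graft s t) - l s\<bar> \<le> e s"
    and e: "(\<Sum>s\<in>S. (4 / 27) ^ steps_size s * e s) \<le> \<epsilon>"
    and l: "\<bar>(\<Sum>s\<in>S. (4 / 27) ^ steps_size s * l s) - L\<bar> \<le> \<epsilon>"
    by blast
  define c where "c n = real (card (trees n))" for n
  define \<rho> where "\<rho> n s = c (n - steps_size s) / c n" for n and s :: "step list"
  have c0: "0 < c n" for n using card_trees_pos[of n] by (simp add: c_def)
  define R where "R n = B * (1 - (\<Sum>s\<in>S. \<rho> n s)) + (\<Sum>s\<in>S. \<rho> n s * e s) + \<bar>(\<Sum>s\<in>S. \<rho> n s * l s) - L\<bar>" for n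
  have lim: "(\<lambda>n. \<rho> n s) \<longlonglongrightarrow> (4 / 27) ^ steps_size s" for s
    unfolding \<rho>_def c_def by (rule card_trees_ratio_shift)
  have "R \<longlonglongrightarrow> B * (1 - (\<Sum>s\<in>S. (4 / 27) ^ steps_size s)) + (\<Sum>s\<in>S. (4 / 27) ^ steps_size s * e s)
      + \<bar>(\<Sum>s\<in>S. (4 / 27) ^ steps_size s * l s) - L\<bar>"
    unfolding R_def by (intro tendsto_intros lim)
  moreover have "B * (1 - (\<Sum>s\<in>S. (4 / 27) ^ steps_size s)) + (\<Sum>s\<in>S. (4 / 27) ^ steps_size s * e s)
      + \<bar>(\<Sum>s\<in>S. (4 / 27) ^ steps_size s * l s) - L\<bar> < r"
  proof -
    have "B * (1 - (\<Sum>s\<in>S. (4 / 27) ^ steps_size s)) \<le> B * \<epsilon>"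
      using q B0 by (intro mult_left_mono) auto
    then show ?thesis using e l \<epsilon> by (auto simp: algebra_simps)
  qed
  ultimately have "\<forall>\<^sub>F n in sequentially. R n < r"
    by (rule order_tendstoD)
  then obtain N where N: "\<And>n. N \<le> n \<Longrightarrow> R n < r" by (auto simp: eventually_sequentially)
  define K where "K = (\<Sum>s\<in>S. steps_size s)"
  have K: "steps_size s \<le> K" if "s \<in> S" for s
    unfolding K_def using S that by (intro member_le_sum) auto
  show "\<exists>no. \<forall>n\<ge>no. norm ((\<Sum>t\<in>trees n. \<phi> t) / real (card (trees n)) - L) < r"
  \<comment> \<open>The steps use at most \<open>K\<close> nodes, so for \<open>n\<close> beyond
    \<open>2 * K\<close> more than \<open>K\<close> nodes remain at the tip, as
    \<open>graft_inj\<close> requires.\<close>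
  proof (intro exI[of _ "N + 2 * K + 1"] allI impI)
    fix n assume n: "N + 2 * K + 1 \<le> n"
    define D where "D = (SIGMA s:S. trees (n - steps_size s))"
    define g where "g = (\<lambda>(s, t). graft s t)"
    have size: "K < nint t" if "s \<in> S" "t \<in> trees (n - steps_size s)" for s t
      using that K[of s] n by (auto simp: trees_def)
    have inj: "inj_on g D"
    proof (rule inj_onI)
      fix x y assume x: "x \<in> D" and y: "y \<in> D" and eq: "g x = g y"
      obtain s t s' t' where xy: "x = (s, t)" "y = (s', t')" by (cases x, cases y)
      have "s = s' \<and> t = t'"
      proof (rule graft_inj[where K = K])
        show "graft s t = graft s' t'" using eq xy by (simp add: g_def)
      qed (use x y xy len K size in \<open>auto simp: D_def\<close>)
      then show "x = y" using xy by simp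
    qed
    have sub: "g ` D \<subseteq> trees n"
      using K n by (fastforce simp: D_def g_def trees_def)
    have finD: "finite D" unfolding D_def using S by auto
    have sum_g: "(\<Sum>t\<in>g ` D. \<psi> t) = (\<Sum>s\<in>S. \<Sum>t\<in>trees (n - steps_size s). \<psi> (graft s t))" for \<psi> :: "ttree \<Rightarrow> real"
    proof -
      have "(\<Sum>t\<in>g ` D. \<psi> t) = (\<Sum>x\<in>D. (\<psi> \<circ> g) x)" by (rule sum.reindex[OF inj])
      then show ?thesis using S by (simp add: D_def sum.Sigma g_def case_prod_beta)
    qed
    have cD: "real (card (g ` D)) = (\<Sum>s\<in>S. c (n - steps_size s))"
      using sum_g[of "\<lambda>_. 1"] by (simp add: c_def)
    have "(\<Sum>t\<in>trees n. \<phi> t) = (\<Sum>t\<in>trees n - g ` D. \<phi> t) + (\<Sum>t\<in>g ` D. \<phi> t)"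
      using sub by (intro sum.subset_diff) auto
    moreover have "\<bar>\<Sum>t\<in>trees n - g ` D. \<phi> t\<bar> \<le> B * (c n - (\<Sum>s\<in>S. c (n - steps_size s)))"
    proof -
      have "\<bar>\<Sum>t\<in>trees n - g ` D. \<phi> t\<bar> \<le> (\<Sum>t\<in>trees n - g ` D. B)"
        by (rule order_trans[OF sum_abs sum_mono]) (rule B)
      also have "\<dots> = B * real (card (trees n - g ` D))" by simp
      also have "real (card (trees n - g ` D)) = c n - real (card (g ` D))"
        using sub finD by (simp add: c_def card_Diff_subset card_mono of_nat_diff)
      finally show ?thesis by (simp only: cD)
    qed
    moreover have "\<bar>(\<Sum>t\<in>g ` D. \<phi> t) - (\<Sum>s\<in>S. c (n - steps_size s) * l s)\<bar> \<le> (\<Sum>s\<in>S. c (n - steps_size s) * e s)"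
    proof -
      have "(\<Sum>t\<in>g ` D. \<phi> t) - (\<Sum>s\<in>S. c (n - steps_size s) * l s) =
          (\<Sum>s\<in>S. \<Sum>t\<in>trees (n - steps_size s). \<phi> (graft s t) - l s)"
        unfolding sum_g by (simp add: sum_subtractf c_def)
      also have "\<bar>\<dots>\<bar> \<le> (\<Sum>s\<in>S. \<Sum>t\<in>trees (n - steps_size s). e s)"
        by (intro order_trans[OF sum_abs] sum_mono le)
      finally show ?thesis by (simp add: c_def)
    qed
    ultimately have "\<bar>(\<Sum>t\<in>trees n. \<phi> t) - c n * L\<bar> \<le> B * (c n - (\<Sum>s\<in>S. c (n - steps_size s))) +
        (\<Sum>s\<in>S. c (n - steps_size s) * e s) + \<bar>(\<Sum>s\<in>S. c (n - steps_size s) * l s) - c n * L\<bar>"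
      by linarith
    also have "\<dots> = c n * R n"
    proof -
      have *: "c (n - steps_size s) = c n * \<rho> n s" for s using c0[of n] by (simp add: \<rho>_def)
      have "(\<Sum>s\<in>S. c (n - steps_size s) * l s) - c n * L = c n * ((\<Sum>s\<in>S. \<rho> n s * l s) - L)"
        unfolding * by (simp add: sum_distrib_left algebra_simps)
      then have "\<bar>(\<Sum>s\<in>S. c (n - steps_size s) * l s) - c n * L\<bar> = c n * \<bar>(\<Sum>s\<in>S. \<rho> n s * l s) - L\<bar>"
        using c0[of n] by (simp add: abs_mult)
      then show ?thesis
        unfolding R_def by (simp add: * sum_distrib_left algebra_simps)
    qed
    also have "\<dots> < c n * r" using N[of n] n c0[of n] by simp
    finally have "\<bar>(\<Sum>t\<in>trees n. \<phi> t) - c n * L\<bar> / c n < r"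
      using c0[of n] by (simp add: divide_less_eq mult.commute)
    moreover have "\<bar>(\<Sum>t\<in>trees n. \<phi> t) - c n * L\<bar> / c n = \<bar>(\<Sum>t\<in>trees n. \<phi> t) / c n - L\<bar>"
    proof -
      have "(\<Sum>t\<in>trees n. \<phi> t) / c n - L = ((\<Sum>t\<in>trees n. \<phi> t) - c n * L) / c n"
        using c0[of n] by (simp add: field_simps)
      then show ?thesis using c0[of n] by simp
    qed
    ultimately show "norm ((\<Sum>t\<in>trees n. \<phi> t) / real (card (trees n)) - L) < r"
      by (simp add: c_def)
  qed
qed

section \<open>Geometry of the nested triangles\<close>

definition triangle_hull :: "complex \<times> complex \<times> complex \<Rightarrow> complex set" where
  "triangle_hull = (\<lambda>(a, b, c). convex hull {a, b, c})"

text \<open>The perimeter is preferred to the diameter because it is a sum of edge lengths: its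
  total over the three parts of a split is bounded by an expression affine in the barycentric
  weights, so only their means enter.\<close>

definition perimeter :: "complex \<times> complex \<times> complex \<Rightarrow> real" where
  "perimeter = (\<lambda>(a, b, c). dist a b + dist b c + dist c a)"

lemma perimeter_nonneg: "0 \<le> perimeter T"
  by (cases T) (simp add: perimeter_def)

lemma dist_triangle_hull_vertex:
  assumes "x \<in> triangle_hull (a, b, c)"
  shows "dist x a \<le> perimeter (a, b, c)"
proof -
  have "triangle_hull (a, b, c) \<subseteq> cball a (perimeter (a, b, c))"
    unfolding triangle_hull_def prod.case
    by (rule hull_minimal) (auto simp: perimeter_def dist_commute)
  then show ?thesis using assms by (auto simp: dist_commute)
qed

lemma barycentre_in_hull:
  assumes "p \<in> open_simplex"
  shows "barycentre p T \<in> triangle_hull T"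
proof (cases T)
  case (fields a b c)
  then show ?thesis
    using barycentre_in_convex[OF assms convex_convex_hull, of a "{a, b, c}" b c]
    by (simp add: triangle_hull_def hull_inc)
qed

lemma subtriangle_hull_subset:
  assumes "M \<in> triangle_hull T"
  shows "triangle_hull (subtriangle i M T) \<subseteq> triangle_hull T"
proof (cases T)
  case (fields a b c)
  have "{a, b, c} \<subseteq> convex hull {a, b, c}" by (rule hull_subset)
  then have "convex hull X \<subseteq> convex hull {a, b, c}" if "X \<subseteq> {M, a, b, c}" for X
    using that assms fields by (intro hull_minimal) (auto simp: triangle_hull_def)
  then show ?thesis
    unfolding fields subtriangle_def triangle_hull_def by simp
qed

lemma triple_hull_subset:
  assumes "\<And>u. P u \<in> open_simplex"
  shows "triangle_hull (triple P (w @ v)) \<subseteq> triangle_hull (triple P w)"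
proof (induction v rule: rev_induct)
  case (snoc i v)
  have "triple P (w @ v @ [i]) = subtriangle i (barycentre (P (w @ v)) (triple P (w @ v))) (triple P (w @ v))"
    by (metis append_assoc triple.simps(2))
  then show ?case
    using subtriangle_hull_subset[OF barycentre_in_hull[OF assms]] snoc by (metis order_trans)
qed simp

lemma split_segments_subset_hull:
  assumes "P u \<in> open_simplex"
  shows "split_segments P u \<subseteq> triangle_hull (triple P u)"
proof (cases "triple P u")
  case (fields a b c)
  have "barycentre (P u) (a, b, c) \<in> convex hull {a, b, c}"
    using barycentre_in_hull[OF assms, of "(a, b, c)"] by (simp add: triangle_hull_def)
  then show ?thesis
    unfolding split_segments_def fields Let_def prod.case triangle_hull_def
    by (intro Un_least closed_segment_subset convex_convex_hull) (auto intro: hull_inc)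
qed

text \<open>Corners are drawn by the splits at proper prefixes, so \<open>w\<close> itself may be a
  leaf. In particular the tip triangle has its corners in the truncated triangulation.\<close>

lemma triple_vertices_subset:
  assumes "\<And>u v. w = u @ v \<Longrightarrow> v \<noteq> [] \<Longrightarrow> u \<in> internal_nodes t" "triple P w = (a, b, c)"
  shows "{a, b, c} \<subseteq> triangulation_set t P"
  using assms
proof (induction w arbitrary: a b c rule: rev_induct)
  case Nil
  then show ?case by (auto simp: triangulation_set_def triangle_boundary_def)
next
  case (snoc i w)
  obtain a' b' c' where T: "triple P w = (a', b', c')" by (cases "triple P w")
  have "{a', b', c'} \<subseteq> triangulation_set t P"
    using snoc.prems(1) T by (intro snoc.IH) auto
  moreover have "barycentre (P w) (a', b', c') \<in> triangulation_set t P"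
  proof -
    have "barycentre (P w) (a', b', c') \<in> split_segments P w"
      by (simp add: T split_segments_def Let_def)
    then show ?thesis using snoc.prems(1)[of w "[i]"] by (auto simp: triangulation_set_def)
  qed
  ultimately show ?case
    using snoc.prems(2) by (auto simp: T subtriangle_def split: if_splits)
qed

subsection \<open>Perimeters\<close>

lemma dist_barycentre_le:
  assumes p: "p \<in> open_simplex"
  shows "dist (barycentre p (a, b, c)) a \<le> p $ 2 * dist a b + p $ 3 * dist c a"
    and "dist (barycentre p (a, b, c)) b \<le> p $ 1 * dist a b + p $ 3 * dist b c"
    and "dist (barycentre p (a, b, c)) c \<le> p $ 1 * dist c a + p $ 2 * dist b c"
proof -
  have pos: "0 < p $ i" for i using p by (simp add: open_simplex_def)
  have s: "p $ 1 = 1 - p $ 2 - p $ 3" "p $ 2 = 1 - p $ 1 - p $ 3" "p $ 3 = 1 - p $ 1 - p $ 2"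
    using p by (auto simp: open_simplex_def)
  have aux: "norm (x *\<^sub>R u + y *\<^sub>R v) \<le> x * norm u + y * norm v" if "0 < x" "0 < y" for x y and u v :: complex
    using norm_triangle_ineq[of "x *\<^sub>R u" "y *\<^sub>R v"] that by simp
  have "barycentre p (a, b, c) - a = p $ 2 *\<^sub>R (b - a) + p $ 3 *\<^sub>R (c - a)"
    unfolding barycentre_def prod.case by (subst s(1)) (simp add: algebra_simps)
  then show "dist (barycentre p (a, b, c)) a \<le> p $ 2 * dist a b + p $ 3 * dist c a"
    using aux[OF pos pos, of 2 "b - a" 3 "c - a"] by (simp add: dist_norm norm_minus_commute)
  have "barycentre p (a, b, c) - b = p $ 1 *\<^sub>R (a - b) + p $ 3 *\<^sub>R (c - b)"
    unfolding barycentre_def prod.case by (subst s(2)) (simp add: algebra_simps)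
  then show "dist (barycentre p (a, b, c)) b \<le> p $ 1 * dist a b + p $ 3 * dist b c"
    using aux[OF pos pos, of 1 "a - b" 3 "c - b"] by (simp add: dist_norm norm_minus_commute)
  have "barycentre p (a, b, c) - c = p $ 1 *\<^sub>R (a - c) + p $ 2 *\<^sub>R (b - c)"
    unfolding barycentre_def prod.case by (subst s(3)) (simp add: algebra_simps)
  then show "dist (barycentre p (a, b, c)) c \<le> p $ 1 * dist c a + p $ 2 * dist b c"
    using aux[OF pos pos, of 1 "a - c" 2 "b - c"] by (simp add: dist_norm norm_minus_commute)
qed

lemma UNIV_three: "(UNIV :: 3 set) = {1, 2, 3}"
  using exhaust_3 by auto

lemma sum_three: "(\<Sum>i\<in>(UNIV :: 3 set). f i) = f 1 + f 2 + f 3"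
  unfolding UNIV_three by (simp add: add.assoc)

text \<open>Each outer edge belongs to one subtriangle, which gives the perimeter once. Each segment
  from the barycentre to a corner borders two subtriangles, whence the factor 2.\<close>

lemma sum_perimeter_subtriangles_le:
  assumes p: "p \<in> open_simplex"
  shows "(\<Sum>i\<in>UNIV. perimeter (subtriangle i (barycentre p (a, b, c)) (a, b, c))) \<le>
    perimeter (a, b, c) + 2 * (dist a b * p $ 1 + dist a b * p $ 2 + dist b c * p $ 2
      + dist b c * p $ 3 + dist c a * p $ 1 + dist c a * p $ 3)"
  using dist_barycentre_le[OF p, of a b c]
  by (simp add: sum_three subtriangle_def perimeter_def distinct_3 dist_commute algebra_simps)

section \<open>Grafted triangulations\<close>

lemma inod_node3_same: "i # u \<in> inod (node3 i a b c) \<longleftrightarrow> u \<in> inod c"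
  using exhaust_3[of i] by (elim disjE) (simp_all add: node3_def)

lemma inod_node3_other: "j \<noteq> i \<Longrightarrow> j # u \<in> inod (node3 i a b c) \<longleftrightarrow> j # u \<in> inod (node3 i a b c')"
  using exhaust_3[of i] exhaust_3[of j] by (elim disjE) (simp_all add: node3_def)

lemma Nil_in_inod_node3 [simp]: "[] \<in> inod (node3 i a b c)"
  by (simp add: node3_def sub3_def)

lemma inod_graft: "u \<in> inod (graft s t) \<longleftrightarrow> u \<in> inod (graft s Lf) \<or> (\<exists>v\<in>inod t. u = map fst s @ v)"
proof (induction s arbitrary: u)
  case (Cons x s)
  show ?case
  proof (cases u)
    case (Cons j u')
    show ?thesis
    proof (cases "j = fst x")
      case True
      then show ?thesis unfolding Cons using Cons.IH[of u'] by (simp add: inod_node3_same)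
    next
      case False
      then show ?thesis
        unfolding Cons using inod_node3_other[OF False, of u' "fst (snd x)" "snd (snd x)" "graft s t" "graft s Lf"]
        by auto
    qed
  qed simp
qed simp

lemma spine_prefix_in_inod_graft: "map fst s = u @ v \<Longrightarrow> v \<noteq> [] \<Longrightarrow> u \<in> inod (graft s t)"
proof (induction s arbitrary: u)
  case (Cons x s)
  then show ?case by (cases u) (auto simp: inod_node3_same)
qed simp

lemma graft_append: "graft (s @ s') t = graft s (graft s' t)"
  by (induction s) auto

abbreviation CT :: "ttree \<Rightarrow> (3 list \<Rightarrow> real ^ 3) \<Rightarrow> triangle_compact" where
  "CT t P \<equiv> compact_triangulation (enc t) P"

lemma Rep_CT:
  "Rep_triangle_compact (CT t P) =
    (if \<forall>u\<in>inod t. P u \<in> open_simplex then triangulation_set (enc t) P else triangle_boundary)"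
  by (simp add: compact_triangulation.rep_eq ternary_tree_enc)

lemma dist_triangle_compact_le_iff:
  "dist K L \<le> r \<longleftrightarrow>
    (\<forall>x\<in>Rep_triangle_compact K. \<exists>y\<in>Rep_triangle_compact L. dist x y \<le> r) \<and>
    (\<forall>y\<in>Rep_triangle_compact L. \<exists>x\<in>Rep_triangle_compact K. dist y x \<le> r)"
  unfolding dist_triangle_compact.rep_eq
  using Rep_triangle_compact[of K] Rep_triangle_compact[of L]
  by (intro hausdorff_distance_le_iff) auto

lemma triangulation_graft_subset:
  "triangulation_set (enc (graft s Lf)) P \<subseteq> triangulation_set (enc (graft s t)) P"
  using inod_graft[of _ s t] by (auto simp: triangulation_set_def)

lemma dist_CT_graft:
  assumes P: "\<And>u. P u \<in> open_simplex"
  shows "dist (CT (graft s t) P) (CT (graft s Lf) P) \<le> perimeter (triple P (map fst s))"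
proof -
  obtain a b c where T: "triple P (map fst s) = (a, b, c)" by (cases "triple P (map fst s)")
  \<comment> \<open>One corner of the tip triangle serves as partner for every new point: it is
    already drawn when the tip is a leaf, and whatever \<open>t\<close> adds stays in the hull of
    that triangle.\<close>
  have a: "a \<in> triangulation_set (enc (graft s Lf)) P"
    using triple_vertices_subset[OF _ T, of "enc (graft s Lf)"] spine_prefix_in_inod_graft[of s _ _ Lf] by auto
  have r0: "0 \<le> perimeter (a, b, c)" by (rule perimeter_nonneg)
  have "\<exists>y\<in>triangulation_set (enc (graft s Lf)) P. dist x y \<le> perimeter (a, b, c)"
    if x: "x \<in> triangulation_set (enc (graft s t)) P" for x
  proof (cases "x \<in> triangulation_set (enc (graft s Lf)) P")
    case True
    then show ?thesis using r0 by (intro bexI[of _ x]) auto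
  next
    case False
    then obtain v where "x \<in> split_segments P (map fst s @ v)"
      using x inod_graft[of _ s t] by (auto simp: triangulation_set_def)
    then have "x \<in> triangle_hull (a, b, c)"
      using split_segments_subset_hull[OF P] triple_hull_subset[of P, OF P, of "map fst s" v] T by fastforce
    then show ?thesis using a dist_triangle_hull_vertex by blast
  qed
  moreover have "\<exists>x\<in>triangulation_set (enc (graft s t)) P. dist y x \<le> perimeter (a, b, c)"
    if "y \<in> triangulation_set (enc (graft s Lf)) P" for y
    using that triangulation_graft_subset[of s P t] r0 by (intro bexI[of _ y]) auto
  ultimately show ?thesis
    unfolding dist_triangle_compact_le_iff by (simp add: Rep_CT P T)
qed

text \<open>For an increasing sequence the closure of the union serves as the limit, so completeness
  of the Hausdorff metric is not invoked. Points of the union satisfy the bound directly; it passes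
  to the closure because the points at distance at most \<open>r h\<close> from \<open>K h\<close>
  form a closed set.\<close>

lemma increasing_limit_triangle_compact:
  fixes K :: "nat \<Rightarrow> triangle_compact"
  assumes inc: "\<And>h k. h \<le> k \<Longrightarrow> Rep_triangle_compact (K h) \<subseteq> Rep_triangle_compact (K k)"
    and le: "\<And>h k. h \<le> k \<Longrightarrow> dist (K k) (K h) \<le> r h"
  shows "\<exists>X. \<forall>h. dist X (K h) \<le> r h"
proof -
  define S where "S = closure (\<Union>h. Rep_triangle_compact (K h))"
  have cl: "compact filled_triangle"
    unfolding filled_triangle_def by (intro finite_imp_compact_convex_hull) auto
  have "(\<Union>h. Rep_triangle_compact (K h)) \<subseteq> filled_triangle"
    using Rep_triangle_compact by auto
  then have sub: "S \<subseteq> filled_triangle"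
    unfolding S_def by (intro closure_minimal compact_imp_closed cl)
  have "compact S"
    using compact_Int_closed[OF cl, of S] sub by (simp add: S_def inf.absorb2)
  moreover have "S \<noteq> {}"
    using Rep_triangle_compact[of "K 0"] closure_subset unfolding S_def by auto
  ultimately have Rep: "Rep_triangle_compact (Abs_triangle_compact S) = S"
    using sub by (intro Abs_triangle_compact_inverse) auto
  have KS: "Rep_triangle_compact (K h) \<subseteq> S" for h
  proof -
    have "Rep_triangle_compact (K h) \<subseteq> (\<Union>h. Rep_triangle_compact (K h))"
      by (rule UN_upper) simp
    also have "\<dots> \<subseteq> S" unfolding S_def by (rule closure_subset)
    finally show ?thesis .
  qed
  have "dist (Abs_triangle_compact S) (K h) \<le> r h" for h
  proof -
    let ?L = "Rep_triangle_compact (K h)"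
    have L: "compact ?L" "?L \<noteq> {}" using Rep_triangle_compact[of "K h"] by auto
    have r0: "0 \<le> r h" using le[of h h] by simp
    have "\<exists>y\<in>?L. dist x y \<le> r h" if "x \<in> Rep_triangle_compact (K k)" for x k
    proof (cases "h \<le> k")
      case True
      then show ?thesis using le[OF True] that unfolding dist_triangle_compact_le_iff by blast
    next
      case False
      then show ?thesis using inc[of k h] that r0 by (intro bexI[of _ x]) auto
    qed
    then have "(\<Union>h. Rep_triangle_compact (K h)) \<subseteq> {x. infdist x ?L \<le> r h}"
      by (auto simp: infdist_le_iff_compact[OF L])
    moreover have "closed {x. infdist x ?L \<le> r h}"
      by (intro closed_Collect_le continuous_intros)
    ultimately have "S \<subseteq> {x. infdist x ?L \<le> r h}"
      unfolding S_def by (rule closure_minimal)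
    then have "\<forall>x\<in>S. \<exists>y\<in>?L. dist x y \<le> r h"
      by (auto simp: infdist_le_iff_compact[OF L])
    moreover have "\<exists>x\<in>S. dist y x \<le> r h" if "y \<in> ?L" for y
    proof (rule bexI[of _ y])
      show "y \<in> S" using that KS[of h] by (simp add: subset_iff)
    qed (simp add: r0)
    ultimately show ?thesis
      unfolding dist_triangle_compact_le_iff Rep by (intro conjI ballI) auto
  qed
  then show ?thesis by blast
qed

section \<open>Measurability of the triangulation\<close>

lemma barycentre_alt: "barycentre p T = p $ 1 *\<^sub>R fst T + p $ 2 *\<^sub>R fst (snd T) + p $ 3 *\<^sub>R snd (snd T)"
  by (simp add: barycentre_def case_prod_beta)

lemma subtriangle_alt: "subtriangle i M T =
    (if i = 1 then (M, fst (snd T), snd (snd T)) else if i = 2 then (fst T, M, snd (snd T))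
     else (fst T, fst (snd T), M))"
  by (simp add: subtriangle_def case_prod_beta)

lemma perimeter_alt:
  "perimeter T = dist (fst T) (fst (snd T)) + dist (fst (snd T)) (snd (snd T)) + dist (snd (snd T)) (fst T)"
  by (simp add: perimeter_def case_prod_beta)

lemma continuous_on_barycentre [continuous_intros]:
  assumes "continuous_on S f" "continuous_on S g"
  shows "continuous_on S (\<lambda>x. barycentre (f x) (g x))"
  unfolding barycentre_alt by (intro continuous_intros assms)

lemma continuous_on_subtriangle [continuous_intros]:
  assumes "continuous_on S f" "continuous_on S g"
  shows "continuous_on S (\<lambda>x. subtriangle i (f x) (g x))"
  unfolding subtriangle_alt by (cases "i = 1"; cases "i = 2") (auto intro!: continuous_intros assms)

lemma continuous_on_perimeter [continuous_intros]:
  assumes "continuous_on S g"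
  shows "continuous_on S (\<lambda>x. perimeter (g x))"
  unfolding perimeter_alt by (intro continuous_intros assms)

lemma continuous_on_triple: "continuous_on UNIV (\<lambda>P. triple P u)"
proof (induction u rule: rev_induct)
  case (snoc i u)
  then show ?case
    unfolding triple.simps by (intro continuous_intros continuous_on_product_coordinates)
qed simp

lemma segment_perturb:
  fixes a b a' b' :: complex
  assumes "x \<in> closed_segment a b"
  shows "\<exists>y\<in>closed_segment a' b'. dist x y \<le> dist a a' + dist b b'"
proof -
  obtain u where u: "0 \<le> u" "u \<le> 1" and x: "x = (1 - u) *\<^sub>R a + u *\<^sub>R b"
    using assms by (auto simp: closed_segment_def)
  have "x - ((1 - u) *\<^sub>R a' + u *\<^sub>R b') = (1 - u) *\<^sub>R (a - a') + u *\<^sub>R (b - b')"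
    unfolding x by (simp add: algebra_simps)
  then have "dist x ((1 - u) *\<^sub>R a' + u *\<^sub>R b') \<le> (1 - u) * dist a a' + u * dist b b'"
    using u norm_triangle_ineq[of "(1 - u) *\<^sub>R (a - a')" "u *\<^sub>R (b - b')"] by (simp add: dist_norm)
  also have "\<dots> \<le> dist a a' + dist b b'"
    using u by (intro add_mono mult_left_le_one_le) auto
  finally show ?thesis
    using u by (intro bexI[of _ "(1 - u) *\<^sub>R a' + u *\<^sub>R b'"]) (auto simp: closed_segment_def)
qed

text \<open>The displacement of the three corners and of the split point. It dominates the movement
  of the three segments and is continuous in \<open>P\<close>, so continuity of the triangulation
  reduces to that of finitely many points.\<close>

definition vertex_change :: "(3 list \<Rightarrow> real ^ 3) \<Rightarrow> (3 list \<Rightarrow> real ^ 3) \<Rightarrow> 3 list \<Rightarrow> real" where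
  "vertex_change P Q u =
    dist (fst (triple P u)) (fst (triple Q u)) + dist (fst (snd (triple P u))) (fst (snd (triple Q u)))
    + dist (snd (snd (triple P u))) (snd (snd (triple Q u)))
    + dist (barycentre (P u) (triple P u)) (barycentre (Q u) (triple Q u))"

lemma vertex_change_commute: "vertex_change P Q u = vertex_change Q P u"
  by (simp add: vertex_change_def dist_commute)

lemma vertex_change_nonneg: "0 \<le> vertex_change P Q u"
  by (simp add: vertex_change_def)

lemma split_segments_perturb:
  assumes "x \<in> split_segments P u"
  shows "\<exists>y\<in>split_segments Q u. dist x y \<le> vertex_change P Q u"
proof -
  obtain a b c where T: "triple P u = (a, b, c)" by (cases "triple P u")
  obtain a' b' c' where T': "triple Q u = (a', b', c')" by (cases "triple Q u")
  let ?M = "barycentre (P u) (a, b, c)" and ?M' = "barycentre (Q u) (a', b', c')"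
  obtain d d' where d: "(d, d') \<in> {(a, a'), (b, b'), (c, c')}" "x \<in> closed_segment d ?M"
    using assms by (auto simp: split_segments_def T Let_def)
  then obtain y where "y \<in> closed_segment d' ?M'" "dist x y \<le> dist d d' + dist ?M ?M'"
    using segment_perturb by blast
  moreover have "dist d d' + dist ?M ?M' \<le> vertex_change P Q u"
    using d(1) by (auto simp: vertex_change_def T T')
  ultimately show ?thesis
    using d(1) by (intro bexI[of _ y]) (auto simp: split_segments_def T' Let_def)
qed

lemma triangulation_set_perturb:
  assumes "x \<in> triangulation_set (enc t) P"
  shows "\<exists>y\<in>triangulation_set (enc t) Q. dist x y \<le> (\<Sum>u\<in>inod t. vertex_change P Q u)"
proof (cases "x \<in> triangle_boundary")
  case True
  then show ?thesis
    by (intro bexI[of _ x]) (auto simp: triangulation_set_def intro!: sum_nonneg vertex_change_nonneg)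
next
  case False
  then obtain u where u: "u \<in> inod t" "x \<in> split_segments P u"
    using assms by (auto simp: triangulation_set_def)
  then obtain y where y: "y \<in> split_segments Q u" "dist x y \<le> vertex_change P Q u"
    using split_segments_perturb by blast
  moreover have "vertex_change P Q u \<le> (\<Sum>u\<in>inod t. vertex_change P Q u)"
    using u by (intro member_le_sum) (auto intro: vertex_change_nonneg)
  ultimately show ?thesis
    using u by (intro bexI[of _ y]) (auto simp: triangulation_set_def)
qed

lemma dist_CT_le:
  assumes "\<forall>u\<in>inod t. P u \<in> open_simplex" "\<forall>u\<in>inod t. Q u \<in> open_simplex"
  shows "dist (CT t P) (CT t Q) \<le> (\<Sum>u\<in>inod t. vertex_change P Q u)"
proof -
  have *: "(\<Sum>u\<in>inod t. vertex_change P Q u) = (\<Sum>u\<in>inod t. vertex_change Q P u)"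
    by (simp add: vertex_change_commute)
  show ?thesis
    unfolding dist_triangle_compact_le_iff Rep_CT if_P[OF assms(1)] if_P[OF assms(2)]
    using triangulation_set_perturb[of _ t P Q] triangulation_set_perturb[of _ t Q P] *
    by auto
qed

text \<open>Continuity is claimed relative to this set only: once a relevant split leaves the open
  simplex, the value is reset to the bare triangle boundary.\<close>

lemma continuous_on_CT: "continuous_on {P. \<forall>u\<in>inod t. P u \<in> open_simplex} (CT t)"
  unfolding continuous_on_def
proof
  let ?A = "{P. \<forall>u\<in>inod t. P u \<in> open_simplex}"
  fix P assume P: "P \<in> ?A"
  have "continuous_on UNIV (\<lambda>Q. \<Sum>u\<in>inod t. vertex_change Q P u)"
    unfolding vertex_change_def
    by (intro continuous_intros continuous_on_triple continuous_on_product_coordinates)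
  then have "((\<lambda>Q. \<Sum>u\<in>inod t. vertex_change Q P u) \<longlongrightarrow> (\<Sum>u\<in>inod t. vertex_change P P u)) (at P within ?A)"
    unfolding continuous_on_def by (meson UNIV_I subset_UNIV tendsto_within_subset)
  then have lim: "((\<lambda>Q. \<Sum>u\<in>inod t. vertex_change Q P u) \<longlongrightarrow> 0) (at P within ?A)"
    by (simp add: vertex_change_def)
  have "\<forall>\<^sub>F Q in at P within ?A. dist (CT t Q) (CT t P) \<le> (\<Sum>u\<in>inod t. vertex_change Q P u)"
    unfolding eventually_at_filter using P by (intro always_eventually) (auto intro!: dist_CT_le)
  then have "((\<lambda>Q. dist (CT t Q) (CT t P)) \<longlongrightarrow> 0) (at P within ?A)"
    by (intro tendsto_sandwich[OF _ _ tendsto_const lim]) auto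
  then show "(CT t \<longlongrightarrow> CT t P) (at P within ?A)"
    by (subst tendsto_dist_iff)
qed

section \<open>Borel measurability in the split vectors\<close>

lemma open_simplex_borel [measurable]: "open_simplex \<in> sets borel"
proof -
  have "open_simplex = {x. 0 < x $ 1} \<inter> {x. 0 < x $ 2} \<inter> {x. 0 < x $ 3} \<inter> {x. x $ 1 + x $ 2 + x $ 3 = 1}"
    by (auto simp: open_simplex_def forall_3)
  also have "\<dots> \<in> sets borel"
    by (intro sets.Int borel_open borel_closed open_Collect_less closed_Collect_eq continuous_intros)
  finally show ?thesis .
qed

abbreviation splits :: "(real ^ 3) measure \<Rightarrow> (3 list \<Rightarrow> real ^ 3) measure" where
  "splits \<nu> \<equiv> \<Pi>\<^sub>M u\<in>(UNIV :: 3 list set). \<nu>"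

text \<open>There are countably many words and \<open>real ^ 3\<close> is second countable, so the
  product sigma-algebra is the Borel one and continuity in \<open>P\<close> yields
  measurability.\<close>

lemma sets_splits: "sets \<nu> = sets borel \<Longrightarrow> sets (splits \<nu>) = sets borel"
  by (subst sets_PiM_cong[of UNIV UNIV _ "\<lambda>_. borel"]) (auto simp: sets_PiM_equal_borel)

lemma borel_measurable_splits:
  assumes "sets \<nu> = sets borel" "f \<in> borel_measurable borel"
  shows "f \<in> borel_measurable (splits \<nu>)"
  by (subst measurable_cong_sets[OF sets_splits[OF assms(1)] refl]) (rule assms(2))

text \<open>The map is continuous on a set that is Borel, being cut out by finitely many
  coordinates, and constant off it.\<close>

lemma borel_measurable_CT: "CT t \<in> borel_measurable borel"
proof -
  let ?A = "{P. \<forall>u\<in>inod t. P u \<in> open_simplex}"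
  have A: "?A \<in> sets borel"
  proof -
    have "(\<lambda>P :: 3 list \<Rightarrow> real ^ 3. P u) \<in> borel_measurable borel" for u
      by (intro borel_measurable_continuous_onI continuous_on_product_coordinates)
    then have "{P :: 3 list \<Rightarrow> real ^ 3. P u \<in> open_simplex} \<in> sets borel" for u
      using measurable_sets[OF _ open_simplex_borel, of "\<lambda>P :: 3 list \<Rightarrow> real ^ 3. P u" borel]
      by (simp add: vimage_def)
    then have "{P \<in> space borel. \<forall>u\<in>inod t. P u \<in> open_simplex} \<in> sets borel"
      by (intro sets.sets_Collect_finite_All) auto
    then show ?thesis by simp
  qed
  define K where "K = Abs_triangle_compact triangle_boundary"
  have "CT t P = K" if "\<not> (\<forall>u\<in>inod t. P u \<in> open_simplex)" for P
    using that Rep_CT[of t P] unfolding K_def by (metis Rep_triangle_compact_inverse)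
  then have eq: "CT t = (\<lambda>P. if P \<in> ?A then CT t P else K)"
    by (auto simp: fun_eq_iff)
  have "(\<lambda>P. if P \<in> ?A then CT t P else K) \<in> borel_measurable borel"
    using A continuous_on_CT[of t]
    by (subst measurable_If_restrict_space_iff) (auto intro: borel_measurable_continuous_on_restrict)
  then show ?thesis using eq by simp
qed

lemma borel_measurable_perimeter_triple: "(\<lambda>P. perimeter (triple P u)) \<in> borel_measurable borel"
  by (intro borel_measurable_continuous_onI continuous_intros continuous_on_triple)

section \<open>Expected perimeters\<close>

lemma triple_cong:
  assumes "\<And>w. length w < length u \<Longrightarrow> P w = Q w"
  shows "triple P u = triple Q u"
  using assms
proof (induction u rule: rev_induct)
  case (snoc i u)
  then have "triple P u = triple Q u" "P u = Q u" by auto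
  then show ?case by simp
qed simp

lemma splitting_law_AE:
  assumes "splitting_law \<nu>"
  shows "AE p in \<nu>. p \<in> open_simplex"
proof -
  have "AE p in \<nu>. \<forall>i. 0 < p $ i"
    using assms by (subst AE_all_countable) (auto simp: splitting_law_def)
  moreover have "AE p in \<nu>. p $ 1 + p $ 2 + p $ 3 = 1"
    using assms by (simp add: splitting_law_def)
  ultimately show ?thesis by eventually_elim (simp add: open_simplex_def)
qed

lemma splitting_law_AE_splits:
  assumes "splitting_law \<nu>"
  shows "AE P in splits \<nu>. \<forall>u. P u \<in> open_simplex"
proof (subst AE_all_countable, rule allI)
  show "AE P in splits \<nu>. P u \<in> open_simplex" for u
    using assms splitting_law_AE[OF assms] by (intro AE_PiM_component) (auto simp: splitting_law_def)
qed

lemma splitting_law_expectation: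
  assumes \<nu>: "splitting_law \<nu>"
  shows "integrable \<nu> (\<lambda>p. p $ i)" "(\<integral>p. p $ i \<partial>\<nu>) = 1 / 3"
proof -
  interpret prob_space \<nu> using \<nu> by (simp add: splitting_law_def)
  have sets [measurable_cong, simp]: "sets \<nu> = sets borel" using \<nu> by (simp add: splitting_law_def)
  have meas: "(\<lambda>p. p $ i) \<in> borel_measurable borel" for i :: 3
    by (intro borel_measurable_continuous_onI continuous_intros)
  then have meas\<nu>: "(\<lambda>p. p $ i) \<in> borel_measurable \<nu>" for i :: 3
    using measurable_cong_sets[OF sets refl, of borel] by auto
  have int: "integrable \<nu> (\<lambda>p. p $ i)" for i
  proof (rule integrable_const_bound[where B = 1])
    show "AE p in \<nu>. norm (p $ i) \<le> 1"
      using splitting_law_AE[OF \<nu>]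
    proof eventually_elim
      case (elim p)
      then have "0 < p $ 1" "0 < p $ 2" "0 < p $ 3" "p $ 1 + p $ 2 + p $ 3 = 1"
        by (auto simp: open_simplex_def)
      then show ?case using exhaust_3[of i] by auto
    qed
  qed (rule meas\<nu>)
  then show "integrable \<nu> (\<lambda>p. p $ i)" .
  have eq: "(\<integral>p. p $ j \<partial>\<nu>) = (\<integral>p. p $ k \<partial>\<nu>)" for j k
  proof -
    let ?\<sigma> = "Transposition.transpose j k"
    have perm: "(\<lambda>p :: real ^ 3. \<chi> i. p $ ?\<sigma> i) \<in> measurable \<nu> borel"
    proof -
      have "(\<lambda>p :: real ^ 3. \<chi> i. p $ ?\<sigma> i) \<in> borel_measurable borel"
        by (intro borel_measurable_continuous_onI continuous_intros)
      then show ?thesis using measurable_cong_sets[OF sets refl, of borel] by auto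
    qed
    have "distr \<nu> borel (\<lambda>p. \<chi> i. p $ ?\<sigma> i) = \<nu>"
      using \<nu> bij_swap by (simp add: splitting_law_def)
    then have "(\<integral>p. p $ j \<partial>\<nu>) = (\<integral>p. p $ j \<partial>distr \<nu> borel (\<lambda>p. \<chi> i. p $ ?\<sigma> i))" by simp
    also have "\<dots> = (\<integral>p. p $ k \<partial>\<nu>)"
      using meas perm by (subst integral_distr) auto
    finally show ?thesis .
  qed
  have "(\<integral>p. p $ 1 + p $ 2 + p $ 3 \<partial>\<nu>) = (\<integral>p. 1 \<partial>\<nu>)"
    using \<nu> meas\<nu> by (intro integral_cong_AE) (auto simp: splitting_law_def)
  then have "(\<integral>p. p $ 1 \<partial>\<nu>) + (\<integral>p. p $ 2 \<partial>\<nu>) + (\<integral>p. p $ 3 \<partial>\<nu>) = 1"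
    using int by (simp add: prob_space)
  then show "(\<integral>p. p $ i \<partial>\<nu>) = 1 / 3"
    using eq[of 1 i] eq[of 2 i] eq[of 3 i] by simp
qed

text \<open>In \<open>L\<close> each edge length carries two of the weights. With mean 1/3 each and
  the factor 2 they contribute 4/3 of the edge, and 1 + 4/3 = 7/3. What matters is that this is
  below 3, the number of subtriangles.\<close>

lemma nn_integral_perimeter_subtriangles_le:
  assumes \<nu>: "splitting_law \<nu>"
  shows "(\<integral>\<^sup>+p. ennreal (\<Sum>i\<in>UNIV. perimeter (subtriangle i (barycentre p T) T)) \<partial>\<nu>) \<le> ennreal (7 / 3 * perimeter T)"
proof -
  interpret prob_space \<nu> using \<nu> by (simp add: splitting_law_def)
  obtain a b c where T: "T = (a, b, c)" by (cases T)
  define L where "L p = perimeter (a, b, c) + 2 * (dist a b * p $ 1 + dist a b * p $ 2 + dist b c * p $ 2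
      + dist b c * p $ 3 + dist c a * p $ 1 + dist c a * p $ 3)" for p :: "real ^ 3"
  note E = splitting_law_expectation[OF \<nu>]
  have int: "integrable \<nu> L"
    unfolding L_def using E(1) by auto
  have "(\<integral>p. L p \<partial>\<nu>) = 7 / 3 * perimeter T"
  proof -
    have "(\<integral>p. L p \<partial>\<nu>) = perimeter (a, b, c) + 2 * (dist a b * (\<integral>p. p $ 1 \<partial>\<nu>) + dist a b * (\<integral>p. p $ 2 \<partial>\<nu>)
      + dist b c * (\<integral>p. p $ 2 \<partial>\<nu>) + dist b c * (\<integral>p. p $ 3 \<partial>\<nu>)
      + dist c a * (\<integral>p. p $ 1 \<partial>\<nu>) + dist c a * (\<integral>p. p $ 3 \<partial>\<nu>))"
      unfolding L_def using E(1) by (simp add: prob_space)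
    then show ?thesis unfolding E(2) by (simp add: T perimeter_def)
  qed
  have le: "AE p in \<nu>. (\<Sum>i\<in>UNIV. perimeter (subtriangle i (barycentre p T) T)) \<le> L p"
    using splitting_law_AE[OF \<nu>] unfolding T L_def
    by eventually_elim (rule sum_perimeter_subtriangles_le)
  then have "(\<integral>\<^sup>+p. ennreal (\<Sum>i\<in>UNIV. perimeter (subtriangle i (barycentre p T) T)) \<partial>\<nu>) \<le> (\<integral>\<^sup>+p. ennreal (L p) \<partial>\<nu>)"
    by (intro nn_integral_mono_AE) (auto simp: ennreal_leI elim: eventually_mono)
  also have "\<dots> = ennreal (\<integral>p. L p \<partial>\<nu>)"
  proof (rule nn_integral_eq_integral[OF int])
    show "AE p in \<nu>. 0 \<le> L p"
      using le by eventually_elim (auto intro: order_trans[OF sum_nonneg] perimeter_nonneg)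
  qed
  also have "(\<integral>p. L p \<partial>\<nu>) = 7 / 3 * perimeter T" by fact
  finally show ?thesis .
qed

text \<open>Independence in the form of resampling: overwriting one coordinate by a fresh copy
  preserves the product law. This lets a single split be integrated while all others stay
  fixed.\<close>

lemma nn_integral_splits_resample:
  assumes "prob_space \<nu>" "f \<in> borel_measurable (splits \<nu>)"
  shows "(\<integral>\<^sup>+P. f P \<partial>splits \<nu>) = (\<integral>\<^sup>+P. \<integral>\<^sup>+x. f (P(u := x)) \<partial>\<nu> \<partial>splits \<nu>)"
proof -
  interpret \<nu>: prob_space \<nu> by fact
  interpret S: prob_space "splits \<nu>" using assms by (intro prob_space_PiM) auto
  interpret pair_sigma_finite \<nu> "splits \<nu>" ..
  have upd: "(\<lambda>(x, P). P(u := x)) \<in> measurable (\<nu> \<Otimes>\<^sub>M splits \<nu>) (splits \<nu>)"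
  proof -
    have "(\<lambda>(x, P). P(u := x)) \<in> measurable (\<nu> \<Otimes>\<^sub>M splits \<nu>) (PiM (insert u UNIV) (\<lambda>_. \<nu>))"
      by measurable
    then show ?thesis by simp
  qed
  have "splits \<nu> = distr (\<nu> \<Otimes>\<^sub>M splits \<nu>) (splits \<nu>) (\<lambda>(x, P). P(u := x))"
    using distr_pair_PiM_eq_PiM[of UNIV "\<lambda>_. \<nu>" u] assms(1) by simp
  then have "(\<integral>\<^sup>+P. f P \<partial>splits \<nu>) = (\<integral>\<^sup>+P. f P \<partial>distr (\<nu> \<Otimes>\<^sub>M splits \<nu>) (splits \<nu>) (\<lambda>(x, P). P(u := x)))"
    by simp
  also have "\<dots> = (\<integral>\<^sup>+z. f (case z of (x, P) \<Rightarrow> P(u := x)) \<partial>(\<nu> \<Otimes>\<^sub>M splits \<nu>))"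
    by (rule nn_integral_distr[OF upd]) (use assms(2) in simp)
  also have "\<dots> = (\<integral>\<^sup>+P. \<integral>\<^sup>+x. f (case (x, P) of (x, P) \<Rightarrow> P(u := x)) \<partial>\<nu> \<partial>splits \<nu>)"
    using upd assms(2) by (intro nn_integral_snd[symmetric]) (auto intro: measurable_compose)
  finally show ?thesis by simp
qed

lemma expected_perimeter_step:
  assumes \<nu>: "splitting_law \<nu>"
  shows "(\<Sum>i\<in>UNIV. \<integral>\<^sup>+P. ennreal (perimeter (triple P (u @ [i]))) \<partial>splits \<nu>) \<le>
    ennreal (7 / 3) * (\<integral>\<^sup>+P. ennreal (perimeter (triple P u)) \<partial>splits \<nu>)"
proof -
  have prob: "prob_space \<nu>" and sets: "sets \<nu> = sets borel" using \<nu> by (auto simp: splitting_law_def)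
  have m: "(\<lambda>P. perimeter (triple P v)) \<in> borel_measurable (splits \<nu>)" for v
    by (rule borel_measurable_splits[OF sets borel_measurable_perimeter_triple])
  then have m': "(\<lambda>P. ennreal (perimeter (triple P v))) \<in> borel_measurable (splits \<nu>)" for v
    by measurable
  \<comment> \<open>The triangle at \<open>u\<close> depends only on splits at shorter words, so
    resampling the split at \<open>u\<close> leaves it fixed and the inner integral concerns one
    deterministic triangle.\<close>
  have same: "triple (P(u := x)) u = triple P u" for P x
    by (rule triple_cong) auto
  have "(\<Sum>i\<in>UNIV. \<integral>\<^sup>+P. ennreal (perimeter (triple P (u @ [i]))) \<partial>splits \<nu>) =
      (\<integral>\<^sup>+P. (\<Sum>i\<in>UNIV. ennreal (perimeter (triple P (u @ [i])))) \<partial>splits \<nu>)"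
    using m' by (intro nn_integral_sum[symmetric])
  also have "\<dots> = (\<integral>\<^sup>+P. ennreal (\<Sum>i\<in>UNIV. perimeter (triple P (u @ [i]))) \<partial>splits \<nu>)"
    by (subst sum_ennreal) (auto intro: perimeter_nonneg)
  also have "\<dots> = (\<integral>\<^sup>+P. \<integral>\<^sup>+x. ennreal (\<Sum>i\<in>UNIV. perimeter (triple (P(u := x)) (u @ [i]))) \<partial>\<nu> \<partial>splits \<nu>)"
    using m by (intro nn_integral_splits_resample[OF prob]) measurable
  also have "\<dots> \<le> (\<integral>\<^sup>+P. ennreal (7 / 3 * perimeter (triple P u)) \<partial>splits \<nu>)"
    using nn_integral_perimeter_subtriangles_le[OF \<nu>] by (intro nn_integral_mono) (simp add: same)
  also have "\<dots> = (\<integral>\<^sup>+P. ennreal (7 / 3) * ennreal (perimeter (triple P u)) \<partial>splits \<nu>)"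
    by (intro nn_integral_cong ennreal_mult perimeter_nonneg) simp
  also have "\<dots> = ennreal (7 / 3) * (\<integral>\<^sup>+P. ennreal (perimeter (triple P u)) \<partial>splits \<nu>)"
    by (rule nn_integral_cmult[OF m'])
  finally show ?thesis .
qed

definition words :: "nat \<Rightarrow> 3 list set" where
  "words h = {u. length u = h}"

lemma finite_words [simp]: "finite (words h)"
  using finite_lists_length_eq[of "UNIV :: 3 set" h] by (simp add: words_def)

lemma sum_words_Suc: "(\<Sum>u\<in>words (Suc h). f u) = (\<Sum>u\<in>words h. \<Sum>i\<in>UNIV. f (u @ [i]))"
proof -
  have "bij_betw (\<lambda>(u, i). u @ [i]) (words h \<times> UNIV) (words (Suc h))"
    by (rule bij_betw_byWitness[where f' = "\<lambda>u. (butlast u, last u)"])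
       (auto simp: words_def length_Suc_conv_rev)
  from sum.reindex_bij_betw[OF this, of f] show ?thesis
    by (simp add: sum.cartesian_product case_prod_beta)
qed

text \<open>Summing over all words prepares the average over directions: a direction word of length
  \<open>h\<close> has probability \<open>(1 / 3) ^ h\<close>, which turns 7/3 into 7/9.\<close>

lemma expected_perimeter_sum:
  assumes \<nu>: "splitting_law \<nu>"
  shows "(\<Sum>u\<in>words h. \<integral>\<^sup>+P. ennreal (perimeter (triple P u)) \<partial>splits \<nu>) \<le>
    ennreal (perimeter (ptA, ptB, ptC) * (7 / 3) ^ h)"
proof (induction h)
  case 0
  interpret S: prob_space "splits \<nu>"
    using \<nu> by (intro prob_space_PiM) (auto simp: splitting_law_def)
  have "words 0 = {[]}" by (auto simp: words_def)
  then show ?case by (simp add: S.emeasure_space_1)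
next
  case (Suc h)
  have "(\<Sum>u\<in>words (Suc h). \<integral>\<^sup>+P. ennreal (perimeter (triple P u)) \<partial>splits \<nu>) \<le>
      (\<Sum>u\<in>words h. ennreal (7 / 3) * (\<integral>\<^sup>+P. ennreal (perimeter (triple P u)) \<partial>splits \<nu>))"
    unfolding sum_words_Suc by (intro sum_mono expected_perimeter_step[OF \<nu>])
  also have "\<dots> = ennreal (7 / 3) * (\<Sum>u\<in>words h. \<integral>\<^sup>+P. ennreal (perimeter (triple P u)) \<partial>splits \<nu>)"
    by (simp add: sum_distrib_left)
  also have "\<dots> \<le> ennreal (7 / 3) * ennreal (perimeter (ptA, ptB, ptC) * (7 / 3) ^ h)"
    by (intro mult_left_mono Suc.IH) auto
  also have "\<dots> = ennreal (perimeter (ptA, ptB, ptC) * (7 / 3) ^ Suc h)"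
    by (simp add: ennreal_mult'[symmetric] algebra_simps)
  finally show ?case .
qed

section \<open>The critical random tree and the spine\<close>

text \<open>Exhausting the trees by height, not by number of nodes, gives finite sets whose masses
  satisfy a one-term recursion. Level 0 is empty, so the iteration starts at mass 0.\<close>

primrec bounded_height :: "nat \<Rightarrow> ttree set" where
  "bounded_height 0 = {}"
| "bounded_height (Suc k) = insert Lf ((\<lambda>(a, b, c). Nd a b c) ` (bounded_height k \<times> bounded_height k \<times> bounded_height k))"

lemma finite_bounded_height [simp]: "finite (bounded_height k)"
  by (induction k) auto

lemma bounded_height_Suc: "bounded_height k \<subseteq> bounded_height (Suc k)"
proof (induction k)
  case (Suc k)
  have "insert Lf ((\<lambda>(a, b, c). Nd a b c) ` (X \<times> X \<times> X)) \<subseteq> insert Lf ((\<lambda>(a, b, c). Nd a b c) ` (Y \<times> Y \<times> Y))"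
    if "X \<subseteq> Y" for X Y
  proof -
    have "X \<times> X \<times> X \<subseteq> Y \<times> Y \<times> Y" using that by auto
    from Set.insert_mono[OF image_mono[OF this]] show ?thesis .
  qed
  from this[OF Suc] show ?case
    unfolding bounded_height.simps(2) .
qed simp

lemma bounded_height_mono: "k \<le> l \<Longrightarrow> bounded_height k \<subseteq> bounded_height l"
  using bounded_height_Suc by (rule lift_Suc_mono_le)

lemma ex_bounded_height: "\<exists>k. t \<in> bounded_height k"
proof (induction t)
  case Lf
  have "Lf \<in> bounded_height (Suc 0)" by simp
  then show ?case by blast
next
  case (Nd a b c)
  then obtain i j k where "a \<in> bounded_height i" "b \<in> bounded_height j" "c \<in> bounded_height k" by blast
  then have "a \<in> bounded_height (i + j + k)" "b \<in> bounded_height (i + j + k)" "c \<in> bounded_height (i + j + k)"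
    using bounded_height_mono[of i "i + j + k"] bounded_height_mono[of j "i + j + k"] bounded_height_mono[of k "i + j + k"]
    by auto
  then have "Nd a b c \<in> bounded_height (Suc (i + j + k))" by force
  then show ?case by blast
qed

definition height_weight :: "nat \<Rightarrow> real" where
  "height_weight k = (\<Sum>t\<in>bounded_height k. (4 / 27) ^ nint t)"

text \<open>The functional equation of the generating function of ternary trees at 4/27, turned into
  an iteration.\<close>

lemma height_weight_Suc: "height_weight (Suc k) = 1 + 4 / 27 * height_weight k ^ 3"
proof -
  let ?H = "bounded_height k"
  have "(\<Sum>t\<in>(\<lambda>(a, b, c). Nd a b c) ` (?H \<times> ?H \<times> ?H). (4 / 27 :: real) ^ nint t)
      = (\<Sum>x\<in>?H \<times> ?H \<times> ?H. ((\<lambda>t. (4 / 27) ^ nint t) \<circ> (\<lambda>(a, b, c). Nd a b c)) x)"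
    by (rule sum.reindex) (auto simp: inj_on_def)
  also have "\<dots> = (\<Sum>(a, b, c)\<in>?H \<times> ?H \<times> ?H. 4 / 27 * ((4 / 27) ^ nint a * ((4 / 27) ^ nint b * (4 / 27) ^ nint c)))"
    by (intro sum.cong) (auto simp: power_add)
  also have "\<dots> = (\<Sum>a\<in>?H. \<Sum>b\<in>?H. \<Sum>c\<in>?H. 4 / 27 * ((4 / 27) ^ nint a * ((4 / 27) ^ nint b * (4 / 27) ^ nint c)))"
    by (simp add: sum.cartesian_product)
  also have "\<dots> = 4 / 27 * (height_weight k * (height_weight k * height_weight k))"
    unfolding height_weight_def by (simp only: sum_distrib_left[symmetric] sum_distrib_right[symmetric])
  finally show ?thesis
    unfolding height_weight_def[of "Suc k"] bounded_height.simps(2)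
    by (subst sum.insert) (auto simp: power3_eq_cube)
qed

lemma height_weight_nonneg: "0 \<le> height_weight k"
  unfolding height_weight_def by (intro sum_nonneg) auto

text \<open>The iterated map is increasing on nonnegative reals and fixes 3/2, so iteration from 0
  never passes this value.\<close>

lemma height_weight_le: "height_weight k \<le> 3 / 2"
proof (induction k)
  case 0
  then show ?case by (simp add: height_weight_def)
next
  case (Suc k)
  have "height_weight k ^ 3 \<le> (3 / 2) ^ 3"
    using Suc height_weight_nonneg by (intro power_mono)
  then show ?case by (simp add: height_weight_Suc power3_eq_cube)
qed

text \<open>The fixed points of \<open>w \<mapsto> 1 + 4 w\<^sup>3 / 27\<close> are the roots of \<open>(2 w - 3)\<^sup>2 (w + 3)\<close>:
  at the critical weight \<open>4 / 27\<close> the total mass of all finite trees is \<open>3 / 2\<close>.\<close>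

lemma height_weight_tendsto: "height_weight \<longlonglongrightarrow> 3 / 2"
proof -
  have "incseq height_weight"
    unfolding height_weight_def by (intro incseq_SucI sum_mono2 finite_bounded_height bounded_height_Suc) simp
  then obtain w where w: "height_weight \<longlonglongrightarrow> w"
    using incseq_convergent[of height_weight "3 / 2"] height_weight_le by blast
  have "(\<lambda>k. height_weight (Suc k)) \<longlonglongrightarrow> 1 + 4 / 27 * w ^ 3"
    unfolding height_weight_Suc by (intro tendsto_intros w)
  then have eq: "w = 1 + 4 / 27 * w ^ 3"
    using LIMSEQ_unique LIMSEQ_Suc[OF w] by blast
  have "0 \<le> w" using w height_weight_nonneg by (intro LIMSEQ_le_const) auto
  moreover have "(2 * w - 3) * ((2 * w - 3) * (w + 3)) = 0" using eq by algebra
  ultimately have "w = 3 / 2" by auto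
  with w show ?thesis by (simp only:)
qed

text \<open>The Galton-Watson law with three children with probability 1/3 and none with probability
  2/3: a tree with \<open>n\<close> internal nodes has \<open>2 n + 1\<close> leaves, and
  (2/3)^(2n+1) * (1/3)^n = 2/3 * (4/27)^n. The mean offspring is 1.\<close>

definition tree_weight :: "ttree \<Rightarrow> real" where
  "tree_weight t = 2 / 3 * (4 / 27) ^ nint t"

lemma nn_integral_tree_weight: "(\<integral>\<^sup>+t. ennreal (tree_weight t) \<partial>count_space UNIV) = 1"
proof -
  define F where "F k t = ennreal (tree_weight t) * indicator (bounded_height k) t" for k t
  have "incseq F"
    using bounded_height_mono unfolding F_def incseq_def le_fun_def
    by (auto intro!: mult_left_mono simp: indicator_def)
  moreover have "(\<lambda>k. F k t) \<longlonglongrightarrow> ennreal (tree_weight t)" for t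
  proof -
    obtain k where k: "t \<in> bounded_height k" using ex_bounded_height by blast
    then have "F l t = ennreal (tree_weight t)" if "k \<le> l" for l
      using bounded_height_mono[OF that] by (auto simp: F_def)
    then have "\<forall>\<^sub>F l in sequentially. F l t = ennreal (tree_weight t)"
      by (auto simp: eventually_sequentially)
    then show ?thesis by (rule tendsto_eventually)
  qed
  ultimately have "(\<lambda>k. \<integral>\<^sup>+t. F k t \<partial>count_space UNIV) \<longlonglongrightarrow> (\<integral>\<^sup>+t. ennreal (tree_weight t) \<partial>count_space UNIV)"
    by (intro nn_integral_LIMSEQ) auto
  moreover have "(\<integral>\<^sup>+t. F k t \<partial>count_space UNIV) = ennreal (2 / 3 * height_weight k)" for k
  proof -
    have "(\<integral>\<^sup>+t. F k t \<partial>count_space UNIV) = (\<integral>\<^sup>+t. ennreal (tree_weight t) \<partial>count_space (bounded_height k))"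
      unfolding F_def by (rule nn_integral_count_space_indicator[symmetric]) simp
    also have "\<dots> = (\<Sum>t\<in>bounded_height k. ennreal (tree_weight t))"
      by (rule nn_integral_count_space_finite) simp
    also have "\<dots> = ennreal (2 / 3 * height_weight k)"
      unfolding height_weight_def by (subst sum_ennreal) (auto simp: tree_weight_def sum_distrib_left)
    finally show ?thesis .
  qed
  moreover have "(\<lambda>k. ennreal (2 / 3 * height_weight k)) \<longlonglongrightarrow> ennreal (2 / 3 * (3 / 2))"
    by (intro tendsto_ennrealI tendsto_intros height_weight_tendsto)
  ultimately show ?thesis
    using LIMSEQ_unique by fastforce
qed

definition tree_law :: "ttree pmf" where
  "tree_law = embed_pmf tree_weight"

lemma pmf_tree_law: "pmf tree_law t = 2 / 3 * (4 / 27) ^ nint t"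
proof -
  have "pmf tree_law t = tree_weight t"
    unfolding tree_law_def using nn_integral_tree_weight
    by (intro pmf_embed_pmf) (auto simp: tree_weight_def)
  then show ?thesis by (simp add: tree_weight_def)
qed

section \<open>The law of the infinite spine\<close>

definition step_law :: "step pmf" where
  "step_law = pair_pmf (pmf_of_set UNIV) (pair_pmf tree_law tree_law)"

text \<open>The uniform direction and the two normalising constants multiply to 1/3 * (2/3)^2 =
  4/27, exactly the weight of the spine node itself. Hence a chain of steps has its limiting
  frequency among uniform trees as its probability.\<close>

lemma pmf_step_law: "pmf step_law x = (4 / 27) ^ step_size x"
proof (cases x)
  case (fields i a b)
  then show ?thesis
    by (simp add: step_law_def pmf_pair pmf_tree_law step_size_def power_add)
qed

lemma emeasure_step_law_direction: "emeasure (measure_pmf step_law) {x. fst x = i} = ennreal (1 / 3)"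
proof -
  have "emeasure (measure_pmf step_law) (fst -` {i}) = emeasure (measure_pmf (map_pmf fst step_law)) {i}"
    by simp
  also have "map_pmf fst step_law = pmf_of_set UNIV"
    by (simp add: step_law_def map_fst_pair_pmf)
  also have "emeasure (measure_pmf (pmf_of_set (UNIV :: 3 set))) {i} = ennreal (1 / 3)"
    by (simp add: emeasure_pmf_single)
  finally show ?thesis by (simp add: vimage_def)
qed

text \<open>The spine of the local limit of the uniform trees. A step \<open>(i, a, b)\<close> says that the spine goes
  on to the \<open>i\<close>-th child and that \<open>a\<close> and \<open>b\<close> are the subtrees at the two other children.\<close>

definition spine :: "(nat \<Rightarrow> step) measure" where
  "spine = (\<Pi>\<^sub>M k\<in>(UNIV :: nat set). measure_pmf step_law)"

lemma prob_space_spine: "prob_space spine"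
  unfolding spine_def by (intro prob_space_PiM) (rule prob_space_measure_pmf)

lemma space_spine [simp]: "space spine = UNIV"
  by (simp add: spine_def space_PiM)

definition spine_prefix :: "(nat \<Rightarrow> step) \<Rightarrow> nat \<Rightarrow> step list" where
  "spine_prefix \<omega> h = map \<omega> [0..<h]"

lemma length_spine_prefix [simp]: "length (spine_prefix \<omega> h) = h"
  by (simp add: spine_prefix_def)

lemma emeasure_spine_cylinder:
  "emeasure spine {\<omega>. \<forall>k\<in>{..<h}. \<omega> k \<in> A k} = (\<Prod>k<h. emeasure (measure_pmf step_law) (A k))"
    and sets_spine_cylinder: "{\<omega>. \<forall>k\<in>{..<h}. \<omega> k \<in> A k} \<in> sets spine"
proof -
  have eq: "{\<omega>. \<forall>k\<in>{..<h}. \<omega> k \<in> A k} =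
      prod_emb UNIV (\<lambda>_. measure_pmf step_law) {..<h} (Pi\<^sub>E {..<h} A)"
    by (rule set_eqI) (simp add: prod_emb_iff restrict_PiE_iff extensional_UNIV Pi_iff)
  show "emeasure spine {\<omega>. \<forall>k\<in>{..<h}. \<omega> k \<in> A k} = (\<Prod>k<h. emeasure (measure_pmf step_law) (A k))"
    unfolding eq spine_def by (intro emeasure_PiM_emb prob_space_measure_pmf) auto
  show "{\<omega>. \<forall>k\<in>{..<h}. \<omega> k \<in> A k} \<in> sets spine"
    unfolding eq spine_def by (intro sets_PiM_I) auto
qed

lemma prefix_eq_iff: "length s = h \<Longrightarrow> spine_prefix \<omega> h = s \<longleftrightarrow> (\<forall>k\<in>{..<h}. \<omega> k \<in> {s ! k})"
  by (auto simp: spine_prefix_def list_eq_iff_nth_eq)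

lemma directions_eq_iff:
  "length u = h \<Longrightarrow> map fst (spine_prefix \<omega> h) = u \<longleftrightarrow> (\<forall>k\<in>{..<h}. \<omega> k \<in> {x. fst x = u ! k})"
  by (auto simp: spine_prefix_def list_eq_iff_nth_eq)

lemma emeasure_prefix:
  assumes "length s = h"
  shows "emeasure spine {\<omega>. spine_prefix \<omega> h = s} = ennreal ((4 / 27) ^ steps_size s)"
proof -
  have "emeasure spine {\<omega>. spine_prefix \<omega> h = s} = (\<Prod>k<h. ennreal ((4 / 27) ^ step_size (s ! k)))"
    unfolding prefix_eq_iff[OF assms] emeasure_spine_cylinder
    by (simp add: emeasure_pmf_single pmf_step_law)
  also have "\<dots> = ennreal (\<Prod>k<h. (4 / 27) ^ step_size (s ! k))"
    by (rule prod_ennreal) simp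
  also have "(\<Prod>k<h. (4 / 27 :: real) ^ step_size (s ! k)) = (4 / 27) ^ steps_size s"
    using assms by (simp add: steps_size_def sum_list_sum_nth power_sum atLeast0LessThan)
  finally show ?thesis .
qed

lemma measure_prefix:
  assumes "length s = h"
  shows "measure spine {\<omega>. spine_prefix \<omega> h = s} = (4 / 27) ^ steps_size s"
  using emeasure_prefix[OF assms] by (simp add: measure_def)

lemma emeasure_directions:
  assumes "length u = h"
  shows "emeasure spine {\<omega>. map fst (spine_prefix \<omega> h) = u} = ennreal ((1 / 3) ^ h)"
  unfolding directions_eq_iff[OF assms] emeasure_spine_cylinder
  by (simp add: emeasure_step_law_direction ennreal_power)

lemma sets_directions: "length u = h \<Longrightarrow> {\<omega>. map fst (spine_prefix \<omega> h) = u} \<in> sets spine"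
  by (simp only: directions_eq_iff sets_spine_cylinder)

lemma measurable_prefix [measurable]: "(\<lambda>\<omega>. spine_prefix \<omega> h) \<in> measurable spine (count_space UNIV)"
proof (subst measurable_count_space_eq2_countable)
  show "(\<lambda>\<omega>. spine_prefix \<omega> h) \<in> space spine \<rightarrow> UNIV \<and>
    (\<forall>s\<in>UNIV. (\<lambda>\<omega>. spine_prefix \<omega> h) -` {s} \<inter> space spine \<in> sets spine)"
  proof (intro conjI ballI)
    fix s
    have eq: "(\<lambda>\<omega>. spine_prefix \<omega> h) -` {s} \<inter> space spine = {\<omega>. spine_prefix \<omega> h = s}" by auto
    show "(\<lambda>\<omega>. spine_prefix \<omega> h) -` {s} \<inter> space spine \<in> sets spine"
    proof (cases "length s = h")
      case True
      then show ?thesis unfolding eq by (simp only: prefix_eq_iff sets_spine_cylinder)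
    next
      case False
      then have "{\<omega>. spine_prefix \<omega> h = s} = {}" by auto
      then show ?thesis unfolding eq by simp
    qed
  qed simp
qed

text \<open>Tightness: the prefixes of length \<open>h\<close> range over a countable set that
  carries mass 1, so a long enough initial part of an enumeration carries nearly all of it.\<close>

lemma exists_finite_prefixes:
  fixes \<epsilon> :: real
  assumes "0 < \<epsilon>"
  shows "\<exists>S. finite S \<and> (\<forall>s\<in>S. length s = h) \<and> 1 - \<epsilon> \<le> (\<Sum>s\<in>S. (4 / 27) ^ steps_size s)"
proof -
  interpret prob_space spine by (rule prob_space_spine)
  define A where "A n = {\<omega>. spine_prefix \<omega> h \<in> from_nat ` {..<n}}" for n :: nat
  have A: "A n \<in> sets spine" for n
    using measurable_sets[OF measurable_prefix, of "from_nat ` {..<n}" h] by (simp add: A_def vimage_def)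
  have "(\<lambda>n. measure spine (A n)) \<longlonglongrightarrow> measure spine (\<Union>n. A n)"
    by (rule finite_Lim_measure_incseq) (use A in \<open>auto simp: A_def incseq_def\<close>)
  moreover have "\<omega> \<in> A (Suc (to_nat (spine_prefix \<omega> h)))" for \<omega>
    unfolding A_def by (auto intro!: image_eqI[of _ _ "to_nat (spine_prefix \<omega> h)"])
  then have "(\<Union>n. A n) = space spine" by auto
  ultimately have "(\<lambda>n. measure spine (A n)) \<longlonglongrightarrow> 1" by (simp only: prob_space)
  moreover have "1 - \<epsilon> < 1" using assms by simp
  ultimately have "\<forall>\<^sub>F n in sequentially. 1 - \<epsilon> < measure spine (A n)" by (rule order_tendstoD)
  then obtain n where n: "1 - \<epsilon> < measure spine (A n)" by (auto simp: eventually_sequentially)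
  let ?S = "from_nat ` {..<n} \<inter> {s :: step list. length s = h}"
  have "spine_prefix \<omega> h \<in> {s. length s = h}" for \<omega> by simp
  then have "A n = (\<Union>s\<in>?S. {\<omega>. spine_prefix \<omega> h = s})" unfolding A_def by blast
  moreover have "measure spine (\<Union>s\<in>?S. {\<omega>. spine_prefix \<omega> h = s}) =
      (\<Sum>s\<in>?S. measure spine {\<omega>. spine_prefix \<omega> h = s})"
  proof (rule finite_measure_finite_Union)
    have "{\<omega>. spine_prefix \<omega> h = s} \<in> sets spine" for s
      using measurable_sets[OF measurable_prefix, of "{s}" h] by (simp add: vimage_def)
    then show "(\<lambda>s. {\<omega>. spine_prefix \<omega> h = s}) ` ?S \<subseteq> sets spine" by blast
  qed (auto simp: disjoint_family_on_def)
  moreover have "(\<Sum>s\<in>?S. measure spine {\<omega>. spine_prefix \<omega> h = s}) = (\<Sum>s\<in>?S. (4 / 27) ^ steps_size s)"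
    by (intro sum.cong measure_prefix) auto
  ultimately have "1 - \<epsilon> \<le> (\<Sum>s\<in>?S. (4 / 27) ^ steps_size s)" using n by (simp only:)
  then show ?thesis by (intro exI[of _ ?S]) auto
qed

section \<open>The limiting triangulation\<close>

locale splitting =
  fixes \<nu> :: "(real ^ 3) measure"
  assumes law: "splitting_law \<nu>"
begin

lemma sets_law: "sets \<nu> = sets borel"
  using law by (simp add: splitting_law_def)

sublocale W: prob_space spine
  by (rule prob_space_spine)

sublocale S: prob_space "splits \<nu>"
  using law by (intro prob_space_PiM) (simp add: splitting_law_def)

abbreviation decorated_spine :: "((nat \<Rightarrow> step) \<times> (3 list \<Rightarrow> real ^ 3)) measure" where
  "decorated_spine \<equiv> spine \<Otimes>\<^sub>M splits \<nu>"

sublocale Q: pair_prob_space spine "splits \<nu>" ..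

abbreviation truncation :: "nat \<Rightarrow> (nat \<Rightarrow> step) \<times> (3 list \<Rightarrow> real ^ 3) \<Rightarrow> triangle_compact" where
  "truncation h z \<equiv> CT (graft (spine_prefix (fst z) h) Lf) (snd z)"

abbreviation tip_perimeter :: "nat \<Rightarrow> (nat \<Rightarrow> step) \<times> (3 list \<Rightarrow> real ^ 3) \<Rightarrow> real" where
  "tip_perimeter h z \<equiv> perimeter (triple (snd z) (map fst (spine_prefix (fst z) h)))"

lemma measurable_CT: "CT t \<in> borel_measurable (splits \<nu>)"
  using sets_law borel_measurable_CT by (rule borel_measurable_splits)

lemma measurable_along_spine:
  assumes "\<And>s. F s \<in> measurable (splits \<nu>) N"
  shows "(\<lambda>z. F (spine_prefix (fst z) h) (snd z)) \<in> measurable decorated_spine N"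
proof (rule measurable_compose_countable[where f = "\<lambda>s z. F s (snd z)" and g = "\<lambda>z. spine_prefix (fst z) h"])
  show "(\<lambda>z. F s (snd z)) \<in> measurable decorated_spine N" for s
    using measurable_compose[OF measurable_snd assms] .
  show "(\<lambda>z. spine_prefix (fst z) h) \<in> measurable decorated_spine (count_space UNIV)"
    using measurable_compose[OF measurable_fst measurable_prefix] .
qed

lemma measurable_perimeter_triple: "(\<lambda>P. perimeter (triple P u)) \<in> borel_measurable (splits \<nu>)"
  using sets_law borel_measurable_perimeter_triple by (rule borel_measurable_splits)

lemma measurable_tip_perimeter: "tip_perimeter h \<in> borel_measurable decorated_spine"
  by (rule measurable_along_spine[of "\<lambda>s P. perimeter (triple P (map fst s))"])
     (rule measurable_perimeter_triple)

lemma measurable_truncation: "truncation h \<in> borel_measurable decorated_spine"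
  by (rule measurable_along_spine[of "\<lambda>s P. CT (graft s Lf) P"]) (rule measurable_CT)

lemma expected_tip_perimeter:
  "(\<integral>\<^sup>+z. ennreal (tip_perimeter h z) \<partial>decorated_spine) \<le> ennreal (perimeter (ptA, ptB, ptC) * (7 / 9) ^ h)"
proof -
  let ?D = "\<lambda>u. {\<omega>. map fst (spine_prefix \<omega> h) = u}"
  let ?p = "\<lambda>u P. ennreal (perimeter (triple P u))"
  have m: "?p u \<in> borel_measurable (splits \<nu>)" for u
    using measurable_perimeter_triple by measurable
  have ind: "indicator (?D u) \<in> borel_measurable spine" if "u \<in> words h" for u
    using sets_directions[of u h] that by (simp add: words_def)
  have mm: "(\<lambda>z. indicator (?D u) (fst z) * ?p u (snd z)) \<in> borel_measurable decorated_spine"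
    if "u \<in> words h" for u
    using measurable_compose[OF measurable_fst ind[OF that]] measurable_compose[OF measurable_snd m]
    by (intro borel_measurable_times_ennreal)
  \<comment> \<open>The side trees do not affect the tip triangle, so it suffices to distinguish the
    direction words. Each term is then a product of a function of the spine and one of the
    splits.\<close>
  have "ennreal (tip_perimeter h z) = (\<Sum>u\<in>words h. indicator (?D u) (fst z) * ?p u (snd z))" for z
  proof -
    have "(\<Sum>u\<in>words h. indicator (?D u) (fst z) * ?p u (snd z)) =
        (\<Sum>u\<in>words h. if map fst (spine_prefix (fst z) h) = u then ?p u (snd z) else 0)"
      by (intro sum.cong) (auto simp: indicator_def)
    also have "\<dots> = ennreal (tip_perimeter h z)"
      by (subst sum.delta'[OF finite_words]) (auto simp: words_def)
    finally show ?thesis by simp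
  qed
  then have "(\<integral>\<^sup>+z. ennreal (tip_perimeter h z) \<partial>decorated_spine) =
      (\<integral>\<^sup>+z. (\<Sum>u\<in>words h. indicator (?D u) (fst z) * ?p u (snd z)) \<partial>decorated_spine)"
    by simp
  also have "\<dots> = (\<Sum>u\<in>words h. \<integral>\<^sup>+z. indicator (?D u) (fst z) * ?p u (snd z) \<partial>decorated_spine)"
    using mm by (intro nn_integral_sum)
  also have "\<dots> = (\<Sum>u\<in>words h. ennreal ((1 / 3) ^ h) * (\<integral>\<^sup>+P. ?p u P \<partial>splits \<nu>))"
  proof (intro sum.cong refl)
    fix u assume u: "u \<in> words h"
    have "(\<integral>\<^sup>+z. indicator (?D u) (fst z) * ?p u (snd z) \<partial>decorated_spine) =
        (\<integral>\<^sup>+\<omega>. \<integral>\<^sup>+P. indicator (?D u) \<omega> * ?p u P \<partial>splits \<nu> \<partial>spine)"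
      using S.nn_integral_fst[OF mm[OF u]] by simp
    also have "\<dots> = (\<integral>\<^sup>+\<omega>. indicator (?D u) \<omega> * (\<integral>\<^sup>+P. ?p u P \<partial>splits \<nu>) \<partial>spine)"
      by (intro nn_integral_cong nn_integral_cmult m)
    also have "\<dots> = (\<integral>\<^sup>+\<omega>. indicator (?D u) \<omega> \<partial>spine) * (\<integral>\<^sup>+P. ?p u P \<partial>splits \<nu>)"
      by (rule nn_integral_multc[OF ind[OF u]])
    also have "(\<integral>\<^sup>+\<omega>. indicator (?D u) \<omega> \<partial>spine) = ennreal ((1 / 3) ^ h)"
      using u sets_directions[of u h] emeasure_directions[of u h] by (simp add: words_def)
    finally show "(\<integral>\<^sup>+z. indicator (?D u) (fst z) * ?p u (snd z) \<partial>decorated_spine) =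
      ennreal ((1 / 3) ^ h) * (\<integral>\<^sup>+P. ?p u P \<partial>splits \<nu>)" .
  qed
  also have "\<dots> = ennreal ((1 / 3) ^ h) * (\<Sum>u\<in>words h. \<integral>\<^sup>+P. ?p u P \<partial>splits \<nu>)"
    by (simp add: sum_distrib_left)
  also have "\<dots> \<le> ennreal ((1 / 3) ^ h) * ennreal (perimeter (ptA, ptB, ptC) * (7 / 3) ^ h)"
    by (intro mult_left_mono expected_perimeter_sum[OF law]) simp
  also have "\<dots> = ennreal ((1 / 3) ^ h * (perimeter (ptA, ptB, ptC) * (7 / 3) ^ h))"
    by (rule ennreal_mult'[symmetric]) simp
  also have "(1 / 3) ^ h * (perimeter (ptA, ptB, ptC) * (7 / 3) ^ h) = perimeter (ptA, ptB, ptC) * (7 / 9 :: real) ^ h"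
    by (simp add: power_divide power_mult_distrib[symmetric])
  finally show ?thesis .
qed

text \<open>The expectations are dominated by a geometric series, so the sum of the tip perimeters
  is almost surely finite and its terms vanish.\<close>

lemma AE_tip_perimeter_tendsto: "AE z in decorated_spine. (\<lambda>h. tip_perimeter h z) \<longlonglongrightarrow> 0"
proof -
  have m: "(\<lambda>z. ennreal (tip_perimeter h z)) \<in> borel_measurable decorated_spine" for h
    using measurable_tip_perimeter by measurable
  have "(\<integral>\<^sup>+z. (\<Sum>h. ennreal (tip_perimeter h z)) \<partial>decorated_spine) =
      (\<Sum>h. \<integral>\<^sup>+z. ennreal (tip_perimeter h z) \<partial>decorated_spine)"
    by (rule nn_integral_suminf[OF m])
  also have "\<dots> \<le> (\<Sum>h. ennreal (perimeter (ptA, ptB, ptC) * (7 / 9) ^ h))"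
    by (intro suminf_le expected_tip_perimeter summableI)
  also have "\<dots> = ennreal (\<Sum>h. perimeter (ptA, ptB, ptC) * (7 / 9) ^ h)"
    by (intro suminf_ennreal2 summable_mult summable_geometric) (auto simp: perimeter_nonneg)
  also have "\<dots> < \<infinity>" by simp
  finally have "AE z in decorated_spine. (\<Sum>h. ennreal (tip_perimeter h z)) \<noteq> \<infinity>"
    using m by (intro nn_integral_PInf_AE borel_measurable_suminf_order) auto
  then show ?thesis
  proof eventually_elim
    case (elim z)
    then have "summable (\<lambda>h. tip_perimeter h z)"
      by (intro summable_suminf_not_top) (auto simp: perimeter_nonneg)
    then show ?case by (rule summable_LIMSEQ_zero)
  qed
qed

lemma AE_decorated_spine_open_simplex: "AE z in decorated_spine. \<forall>u. snd z u \<in> open_simplex"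
proof -
  obtain N where N: "{P \<in> space (splits \<nu>). \<not> (\<forall>u. P u \<in> open_simplex)} \<subseteq> N"
      "emeasure (splits \<nu>) N = 0" "N \<in> sets (splits \<nu>)"
    using splitting_law_AE_splits[OF law] by (rule AE_E)
  show ?thesis
  proof (rule AE_I[of _ _ "space spine \<times> N"])
    show "{z \<in> space decorated_spine. \<not> (\<forall>u. snd z u \<in> open_simplex)} \<subseteq> space spine \<times> N"
      by (auto simp: space_pair_measure intro!: subsetD[OF N(1)])
    show "emeasure decorated_spine (space spine \<times> N) = 0"
      using N sets.top[of spine] by (subst S.emeasure_pair_measure_Times) auto
    show "space spine \<times> N \<in> sets decorated_spine"
      using N(3) by (intro pair_measureI sets.top)
  qed
qed

lemma prefix_append: "h \<le> k \<Longrightarrow> spine_prefix \<omega> k = spine_prefix \<omega> h @ map \<omega> [h..<k]"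
  unfolding spine_prefix_def map_append[symmetric] by (metis le_add_diff_inverse upt_add_eq_append zero_le)

lemma truncations_converge:
  assumes P: "\<And>u. snd z u \<in> open_simplex"
  shows "\<exists>X. \<forall>h. dist X (truncation h z) \<le> tip_perimeter h z"
proof (rule increasing_limit_triangle_compact)
  fix h k :: nat assume "h \<le> k"
  then have eq: "graft (spine_prefix (fst z) k) Lf = graft (spine_prefix (fst z) h) (graft (map (fst z) [h..<k]) Lf)"
    by (simp add: prefix_append graft_append)
  show "Rep_triangle_compact (truncation h z) \<subseteq> Rep_triangle_compact (truncation k z)"
    unfolding eq using triangulation_graft_subset by (simp add: Rep_CT P)
  show "dist (truncation k z) (truncation h z) \<le> tip_perimeter h z"
    unfolding eq by (rule dist_CT_graft[OF P])
qed

lemma limit_exists: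
  "\<exists>X \<in> borel_measurable decorated_spine. AE z in decorated_spine.
    (\<forall>u. snd z u \<in> open_simplex) \<and> (\<lambda>h. tip_perimeter h z) \<longlonglongrightarrow> 0 \<and>
    (\<forall>h. dist (X z) (truncation h z) \<le> tip_perimeter h z)"
proof -
  have "AE z in decorated_spine. (\<forall>u. snd z u \<in> open_simplex) \<and> (\<lambda>h. tip_perimeter h z) \<longlonglongrightarrow> 0"
    using AE_decorated_spine_open_simplex AE_tip_perimeter_tendsto by eventually_elim blast
  then obtain N where N: "{z \<in> space decorated_spine. \<not> ((\<forall>u. snd z u \<in> open_simplex) \<and> (\<lambda>h. tip_perimeter h z) \<longlonglongrightarrow> 0)} \<subseteq> N"
      "emeasure decorated_spine N = 0" "N \<in> sets decorated_spine"
    by (rule AE_E)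
  define K where "K = Abs_triangle_compact triangle_boundary"
  \<comment> \<open>The pointwise choice carries no measurability. That is recovered below: off the
    null set \<open>N\<close> the value is the limit of the measurable truncations, and on
    \<open>N\<close> it is constant.\<close>
  define X where "X z = (if z \<in> N then K else (SOME X. \<forall>h. dist X (truncation h z) \<le> tip_perimeter h z))" for z
  have good: "(\<forall>u. snd z u \<in> open_simplex) \<and> (\<lambda>h. tip_perimeter h z) \<longlonglongrightarrow> 0"
    if "z \<in> space decorated_spine" "z \<notin> N" for z
    using N(1) that by blast
  have X: "dist (X z) (truncation h z) \<le> tip_perimeter h z" if "z \<in> space decorated_spine" "z \<notin> N" for z h
    using someI_ex[OF truncations_converge[of z]] good[OF that] that by (simp add: X_def)
  have "X \<in> borel_measurable decorated_spine"
  proof (rule borel_measurable_LIMSEQ_metric)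
    show "(\<lambda>z. if z \<in> N then K else truncation h z) \<in> borel_measurable decorated_spine" for h
      using N(3) by (intro measurable_If_set measurable_truncation) auto
    fix z assume z: "z \<in> space decorated_spine"
    show "(\<lambda>h. if z \<in> N then K else truncation h z) \<longlonglongrightarrow> X z"
    proof (cases "z \<in> N")
      case False
      have "(\<lambda>h. dist (truncation h z) (X z)) \<longlonglongrightarrow> 0"
        by (rule tendsto_sandwich[OF _ _ tendsto_const conjunct2[OF good[OF z False]]])
           (use X[OF z False] in \<open>auto simp: dist_commute\<close>)
      then show ?thesis using False by (simp add: tendsto_dist_iff[of _ "X z"])
    qed (simp add: X_def)
  qed
  moreover have "AE z in decorated_spine. z \<notin> N"
    using N by (intro AE_not_in) (auto simp: null_sets_def)
  then have "AE z in decorated_spine. (\<forall>u. snd z u \<in> open_simplex) \<and> (\<lambda>h. tip_perimeter h z) \<longlonglongrightarrow> 0 \<and>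
    (\<forall>h. dist (X z) (truncation h z) \<le> tip_perimeter h z)"
    using AE_space by eventually_elim (use good X in blast)
  ultimately show ?thesis by blast
qed

text \<open>The bridge between the two models: an integral over the infinite tree, restricted to
  finitely many prefixes, is the weighted sum appearing in
  \<open>uniform_tree_average_tendsto\<close>.\<close>

lemma integral_finite_prefixes:
  fixes F :: "step list \<Rightarrow> (3 list \<Rightarrow> real ^ 3) \<Rightarrow> real"
  assumes S: "finite S" "\<And>s. s \<in> S \<Longrightarrow> length s = h"
    and F: "\<And>s. F s \<in> borel_measurable (splits \<nu>)" "\<And>s P. \<bar>F s P\<bar> \<le> B"
  shows "(\<integral>z. indicator S (spine_prefix (fst z) h) * F (spine_prefix (fst z) h) (snd z) \<partial>decorated_spine) =
    (\<Sum>s\<in>S. (4 / 27) ^ steps_size s * (\<integral>P. F s P \<partial>splits \<nu>))"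
proof -
  let ?D = "\<lambda>s. {\<omega>. spine_prefix \<omega> h = s}"
  have D: "?D s \<in> sets spine" for s
    using measurable_sets[OF measurable_prefix, of "{s}" h] by (simp add: vimage_def)
  have B: "0 \<le> B" using F(2)[of "[]"] by (meson abs_ge_zero order_trans)
  have int: "integrable decorated_spine (\<lambda>z. indicator (?D s) (fst z) * F s (snd z))" for s
  proof (rule Q.P.integrable_const_bound[where B = B])
    have "indicator (?D s) \<in> borel_measurable spine" using D[of s] by simp
    then show "(\<lambda>z. indicator (?D s) (fst z) * F s (snd z)) \<in> borel_measurable decorated_spine"
      by (intro borel_measurable_times measurable_compose[OF measurable_fst] measurable_compose[OF measurable_snd F(1)])
  qed (use F(2)[of s] B in \<open>auto simp: indicator_def\<close>)
  have "indicator S (spine_prefix (fst z) h) * F (spine_prefix (fst z) h) (snd z) =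
      (\<Sum>s\<in>S. indicator (?D s) (fst z) * F s (snd z))" for z
  proof -
    have "(\<Sum>s\<in>S. indicator (?D s) (fst z) * F s (snd z)) =
        (\<Sum>s\<in>S. if spine_prefix (fst z) h = s then F s (snd z) else 0)"
      by (intro sum.cong) (auto simp: indicator_def)
    also have "\<dots> = indicator S (spine_prefix (fst z) h) * F (spine_prefix (fst z) h) (snd z)"
      using S(1) by (subst sum.delta') (auto simp: indicator_def)
    finally show ?thesis by simp
  qed
  then have "(\<integral>z. indicator S (spine_prefix (fst z) h) * F (spine_prefix (fst z) h) (snd z) \<partial>decorated_spine) =
      (\<Sum>s\<in>S. \<integral>z. indicator (?D s) (fst z) * F s (snd z) \<partial>decorated_spine)"
    using int by (simp add: Bochner_Integration.integral_sum)
  also have "\<dots> = (\<Sum>s\<in>S. (4 / 27) ^ steps_size s * (\<integral>P. F s P \<partial>splits \<nu>))"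
  proof (intro sum.cong refl)
    fix s assume s: "s \<in> S"
    have "(\<integral>z. indicator (?D s) (fst z) * F s (snd z) \<partial>decorated_spine) =
        (\<integral>\<omega>. \<integral>P. indicator (?D s) \<omega> * F s P \<partial>splits \<nu> \<partial>spine)"
      using Q.integral_fst'[OF int[of s]] by simp
    also have "\<dots> = (\<integral>\<omega>. indicator (?D s) \<omega> \<partial>spine) * (\<integral>P. F s P \<partial>splits \<nu>)"
      by simp
    also have "(\<integral>\<omega>. indicat_real (?D s) \<omega> \<partial>spine) = (4 / 27) ^ steps_size s"
      using D[of s] measure_prefix[of s h] S(2)[OF s] by simp
    finally show "(\<integral>z. indicator (?D s) (fst z) * F s (snd z) \<partial>decorated_spine) =
      (4 / 27) ^ steps_size s * (\<integral>P. F s P \<partial>splits \<nu>)" .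
  qed
  finally show ?thesis .
qed

end

section \<open>Convergence of the expectations\<close>

context splitting
begin

context
  fixes f :: "triangle_compact \<Rightarrow> real" and B :: real
  assumes f: "continuous_on UNIV f" and B: "\<And>K. \<bar>f K\<bar> \<le> B"
begin

lemma measurable_f: "f \<in> borel_measurable borel"
  using f by (rule borel_measurable_continuous_onI)

lemma measurable_f_CT: "(\<lambda>P. f (CT t P)) \<in> borel_measurable (splits \<nu>)"
  by (rule measurable_compose[OF measurable_CT measurable_f])

lemma integrable_f_CT: "integrable (splits \<nu>) (\<lambda>P. f (CT t P))"
  by (rule S.integrable_const_bound[where B = B]) (use B measurable_f_CT in auto)

text \<open>The largest effect on the test function of whatever tree sits at the tip, for fixed
  splits. The supremum runs over a countable type, which keeps it measurable in
  \<open>P\<close>.\<close>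

definition oscillation :: "step list \<Rightarrow> (3 list \<Rightarrow> real ^ 3) \<Rightarrow> real" where
  "oscillation s P = (SUP t. \<bar>f (CT (graft s t) P) - f (CT (graft s Lf) P)\<bar>)"

lemma f_diff_le: "\<bar>f K - f L\<bar> \<le> 2 * B"
  using B[of K] B[of L] by linarith

lemma bdd_oscillation: "bdd_above (range (\<lambda>t. \<bar>f (CT (graft s t) P) - f (CT (graft s Lf) P)\<bar>))"
  by (rule bdd_aboveI[of _ "2 * B"]) (auto intro: f_diff_le)

lemma le_oscillation: "\<bar>f (CT (graft s t) P) - f (CT (graft s Lf) P)\<bar> \<le> oscillation s P"
  unfolding oscillation_def by (rule cSUP_upper[OF UNIV_I bdd_oscillation])

lemma oscillation_le:
  assumes "\<And>t. \<bar>f (CT (graft s t) P) - f (CT (graft s Lf) P)\<bar> \<le> r"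
  shows "oscillation s P \<le> r"
  unfolding oscillation_def using assms by (intro cSUP_least) auto

lemma oscillation_nonneg: "0 \<le> oscillation s P"
  using le_oscillation[of s Lf P] by simp

lemma abs_oscillation_le: "\<bar>oscillation s P\<bar> \<le> 2 * B"
  using oscillation_nonneg[of s P] oscillation_le[of s P, OF f_diff_le] by simp

lemma measurable_oscillation: "oscillation s \<in> borel_measurable (splits \<nu>)"
  unfolding oscillation_def
  by (intro borel_measurable_cSUP borel_measurable_abs borel_measurable_diff measurable_f_CT bdd_oscillation)
     auto

lemma integrable_oscillation: "integrable (splits \<nu>) (oscillation s)"
  by (rule S.integrable_const_bound[where B = "2 * B"]) (use abs_oscillation_le measurable_oscillation in auto)

section \<open>Passage to the limit along the spine\<close>

context
  fixes X :: "(nat \<Rightarrow> step) \<times> (3 list \<Rightarrow> real ^ 3) \<Rightarrow> triangle_compact"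
  assumes X: "X \<in> borel_measurable decorated_spine"
    and lim: "AE z in decorated_spine. (\<forall>u. snd z u \<in> open_simplex) \<and> (\<lambda>h. tip_perimeter h z) \<longlonglongrightarrow> 0 \<and>
      (\<forall>h. dist (X z) (truncation h z) \<le> tip_perimeter h z)"
begin

lemma truncation_integral_tendsto:
  "(\<lambda>h. \<integral>z. f (truncation h z) \<partial>decorated_spine) \<longlonglongrightarrow> (\<integral>z. f (X z) \<partial>decorated_spine)"
proof (rule integral_dominated_convergence[where w = "\<lambda>_. B"])
  show "AE z in decorated_spine. (\<lambda>h. f (truncation h z)) \<longlonglongrightarrow> f (X z)"
    using lim
  proof eventually_elim
    case (elim z)
    have "(\<lambda>h. dist (truncation h z) (X z)) \<longlonglongrightarrow> 0"
      by (rule tendsto_sandwich[OF _ _ tendsto_const, of _ _ _ "\<lambda>h. tip_perimeter h z"])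
         (use elim in \<open>auto simp: dist_commute\<close>)
    then have "(\<lambda>h. truncation h z) \<longlonglongrightarrow> X z" by (subst tendsto_dist_iff)
    from continuous_on_tendsto_compose[OF f this] show ?case by simp
  qed
qed (use B measurable_compose[OF X measurable_f] measurable_compose[OF measurable_truncation measurable_f] in auto)

text \<open>Every triangulation grafted at height \<open>h\<close> lies within two tip perimeters of
  \<open>X z\<close>, uniformly in the grafted tree. Continuity of \<open>f\<close> at this one
  point therefore controls the whole supremum.\<close>

lemma oscillation_tendsto:
  assumes P: "\<forall>u. snd z u \<in> open_simplex" and tip: "(\<lambda>h. tip_perimeter h z) \<longlonglongrightarrow> 0"
    and Xz: "\<forall>h. dist (X z) (truncation h z) \<le> tip_perimeter h z"
  shows "(\<lambda>h. oscillation (spine_prefix (fst z) h) (snd z)) \<longlonglongrightarrow> 0"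
proof (rule LIMSEQ_I)
  fix r :: real assume r: "0 < r"
  obtain d where d: "0 < d" "\<And>Y. dist Y (X z) < d \<Longrightarrow> dist (f Y) (f (X z)) < r / 3"
    using f[unfolded continuous_on_iff, rule_format, of "X z" "r / 3"] r by auto
  have "\<forall>\<^sub>F h in sequentially. tip_perimeter h z < d / 2"
    using order_tendstoD(2)[OF tip, of "d / 2"] d(1) by simp
  then obtain h0 where h0: "\<And>h. h0 \<le> h \<Longrightarrow> tip_perimeter h z < d / 2"
    by (auto simp: eventually_sequentially)
  show "\<exists>h0. \<forall>h\<ge>h0. norm (oscillation (spine_prefix (fst z) h) (snd z) - 0) < r"
  proof (intro exI allI impI)
    fix h assume h: "h0 \<le> h"
    have near: "dist (CT (graft (spine_prefix (fst z) h) t) (snd z)) (X z) < d" for t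
    proof -
      have "dist (CT (graft (spine_prefix (fst z) h) t) (snd z)) (truncation h z) \<le> tip_perimeter h z"
        using P by (intro dist_CT_graft) simp
      moreover have "dist (X z) (truncation h z) \<le> tip_perimeter h z" using Xz by blast
      ultimately show ?thesis
        using h0[OF h] dist_triangle2[of "CT (graft (spine_prefix (fst z) h) t) (snd z)" "X z" "truncation h z"]
        by linarith
    qed
    have "oscillation (spine_prefix (fst z) h) (snd z) \<le> 2 * r / 3"
    proof (rule oscillation_le)
      fix t
      show "\<bar>f (CT (graft (spine_prefix (fst z) h) t) (snd z)) - f (truncation h z)\<bar> \<le> 2 * r / 3"
        using d(2)[OF near[of t]] d(2)[OF near[of Lf]] unfolding dist_real_def by linarith
    qed
    then show "norm (oscillation (spine_prefix (fst z) h) (snd z) - 0) < r"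
      using oscillation_nonneg[of "spine_prefix (fst z) h" "snd z"] r by simp
  qed
qed

lemma measurable_oscillation_spine:
  "(\<lambda>z. oscillation (spine_prefix (fst z) h) (snd z)) \<in> borel_measurable decorated_spine"
  by (rule measurable_along_spine[of oscillation, OF measurable_oscillation])

lemma oscillation_integral_tendsto:
  "(\<lambda>h. \<integral>z. oscillation (spine_prefix (fst z) h) (snd z) \<partial>decorated_spine) \<longlonglongrightarrow> 0"
proof -
  have "(\<lambda>h. \<integral>z. oscillation (spine_prefix (fst z) h) (snd z) \<partial>decorated_spine) \<longlonglongrightarrow> (\<integral>z. 0 \<partial>decorated_spine)"
  proof (rule integral_dominated_convergence[where w = "\<lambda>_. 2 * B"])
    show "AE z in decorated_spine. (\<lambda>h. oscillation (spine_prefix (fst z) h) (snd z)) \<longlonglongrightarrow> 0"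
      using lim by eventually_elim (intro oscillation_tendsto; blast)
  qed (use abs_oscillation_le measurable_oscillation_spine in auto)
  then show ?thesis by simp
qed

lemma uniform_expectation_tendsto:
  "(\<lambda>n. (\<Sum>t\<in>trees n. \<integral>P. f (CT t P) \<partial>splits \<nu>) / real (card (trees n)))
    \<longlonglongrightarrow> (\<integral>z. f (X z) \<partial>decorated_spine)"
proof (rule uniform_tree_average_tendsto[where B = B])
  show "\<bar>\<integral>P. f (CT t P) \<partial>splits \<nu>\<bar> \<le> B" for t
  proof -
    have "\<bar>\<integral>P. f (CT t P) \<partial>splits \<nu>\<bar> \<le> (\<integral>P. \<bar>f (CT t P)\<bar> \<partial>splits \<nu>)"
      by (rule integral_abs_bound)
    also have "\<dots> \<le> (\<integral>P. B \<partial>splits \<nu>)"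
      using integrable_f_CT B by (intro integral_mono) auto
    finally show ?thesis by (simp add: S.prob_space)
  qed
  fix \<epsilon> :: real assume \<epsilon>: "0 < \<epsilon>"
  let ?L = "\<integral>z. f (X z) \<partial>decorated_spine"
  have B0: "0 \<le> B" using B[of undefined] by linarith
  have "\<forall>\<^sub>F h in sequentially. dist (\<integral>z. f (truncation h z) \<partial>decorated_spine) ?L < \<epsilon> / 2"
    using tendstoD[OF truncation_integral_tendsto, of "\<epsilon> / 2"] \<epsilon> by simp
  moreover have "\<forall>\<^sub>F h in sequentially. (\<integral>z. oscillation (spine_prefix (fst z) h) (snd z) \<partial>decorated_spine) < \<epsilon>"
    using oscillation_integral_tendsto \<epsilon> by (rule order_tendstoD)
  ultimately have "\<forall>\<^sub>F h in sequentially. dist (\<integral>z. f (truncation h z) \<partial>decorated_spine) ?L < \<epsilon> / 2 \<and>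
      (\<integral>z. oscillation (spine_prefix (fst z) h) (snd z) \<partial>decorated_spine) < \<epsilon>"
    by (rule eventually_conj)
  then obtain h where h1: "\<bar>(\<integral>z. f (truncation h z) \<partial>decorated_spine) - ?L\<bar> < \<epsilon> / 2"
    and h2: "(\<integral>z. oscillation (spine_prefix (fst z) h) (snd z) \<partial>decorated_spine) < \<epsilon>"
    unfolding eventually_sequentially dist_real_def by blast
  \<comment> \<open>Restricting to the prefixes in \<open>S\<close> costs at most
    \<open>B * \<delta>\<close>, half of the allowed error; truncation at height \<open>h\<close>
    takes the other half. \<open>B + 1\<close> keeps the denominator positive.\<close>
  define \<delta> where "\<delta> = min \<epsilon> (\<epsilon> / (2 * (B + 1)))"
  have \<delta>: "0 < \<delta>" "\<delta> \<le> \<epsilon>" using \<epsilon> B0 by (auto simp: \<delta>_def)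
  have "B * \<delta> \<le> (B + 1) * (\<epsilon> / (2 * (B + 1)))"
    using B0 \<delta> by (intro mult_mono) (auto simp: \<delta>_def)
  also have "\<dots> = \<epsilon> / 2"
  proof -
    have "c * (\<epsilon> / (2 * c)) = \<epsilon> / 2" if "0 < c" for c using that by simp
    note half = this
    show ?thesis by (rule half) (use B0 in simp)
  qed
  finally have B\<delta>: "B * \<delta> \<le> \<epsilon> / 2" .
  obtain S where S: "finite S" "\<And>s. s \<in> S \<Longrightarrow> length s = h"
    and mass: "1 - \<delta> \<le> (\<Sum>s\<in>S. (4 / 27) ^ steps_size s)"
    using exists_finite_prefixes[OF \<delta>(1), of h] by blast
  define I :: "(nat \<Rightarrow> step) \<times> (3 list \<Rightarrow> real ^ 3) \<Rightarrow> real" where "I z = indicator S (spine_prefix (fst z) h)" for z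
  have I01: "0 \<le> I z" "I z \<le> 1" for z by (auto simp: I_def)
  have I: "I \<in> borel_measurable decorated_spine"
    unfolding I_def by (rule measurable_along_spine[of "\<lambda>s _. indicator S s"]) simp
  have intI: "integrable decorated_spine I"
    by (rule Q.P.integrable_const_bound[where B = 1]) (use I I01 in auto)
  have int_osc: "integrable decorated_spine (\<lambda>z. oscillation (spine_prefix (fst z) h) (snd z))"
    by (rule Q.P.integrable_const_bound[where B = "2 * B"])
       (use measurable_oscillation_spine abs_oscillation_le in auto)
  have trunc: "(\<lambda>z. f (truncation h z)) \<in> borel_measurable decorated_spine"
    by (rule measurable_compose[OF measurable_truncation measurable_f])
  have int_trunc: "integrable decorated_spine (\<lambda>z. f (truncation h z))"
    by (rule Q.P.integrable_const_bound[where B = B]) (use trunc B in auto)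
  have int_I_trunc: "integrable decorated_spine (\<lambda>z. I z * f (truncation h z))"
    by (rule Bochner_Integration.integrable_bound[OF int_trunc])
       (use I trunc I01 in \<open>auto simp: abs_mult intro!: mult_left_le_one_le\<close>)
  have int_I_osc: "integrable decorated_spine (\<lambda>z. I z * oscillation (spine_prefix (fst z) h) (snd z))"
    by (rule Bochner_Integration.integrable_bound[OF int_osc])
       (use I measurable_oscillation_spine I01 in \<open>auto simp: abs_mult intro!: mult_left_le_one_le\<close>)
  have sumI: "(\<integral>z. I z \<partial>decorated_spine) = (\<Sum>s\<in>S. (4 / 27) ^ steps_size s)"
    using integral_finite_prefixes[OF S, of "\<lambda>_ _. 1" 1] by (simp add: I_def S.prob_space)
  have sum_trunc: "(\<integral>z. I z * f (truncation h z) \<partial>decorated_spine) =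
      (\<Sum>s\<in>S. (4 / 27) ^ steps_size s * (\<integral>P. f (CT (graft s Lf) P) \<partial>splits \<nu>))"
    unfolding I_def by (rule integral_finite_prefixes[OF S measurable_f_CT B])
  have sum_osc: "(\<integral>z. I z * oscillation (spine_prefix (fst z) h) (snd z) \<partial>decorated_spine) =
      (\<Sum>s\<in>S. (4 / 27) ^ steps_size s * (\<integral>P. oscillation s P \<partial>splits \<nu>))"
    unfolding I_def by (rule integral_finite_prefixes[OF S measurable_oscillation abs_oscillation_le])
  have A: "\<forall>s\<in>S. \<forall>t. \<bar>(\<integral>P. f (CT (graft s t) P) \<partial>splits \<nu>) - (\<integral>P. f (CT (graft s Lf) P) \<partial>splits \<nu>)\<bar>
      \<le> (\<integral>P. oscillation s P \<partial>splits \<nu>)"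
  proof (intro ballI allI)
    fix s t
    have "(\<integral>P. f (CT (graft s t) P) \<partial>splits \<nu>) - (\<integral>P. f (CT (graft s Lf) P) \<partial>splits \<nu>) =
        (\<integral>P. f (CT (graft s t) P) - f (CT (graft s Lf) P) \<partial>splits \<nu>)"
      by (rule Bochner_Integration.integral_diff[symmetric]) (rule integrable_f_CT)+
    also have "\<bar>\<dots>\<bar> \<le> (\<integral>P. \<bar>f (CT (graft s t) P) - f (CT (graft s Lf) P)\<bar> \<partial>splits \<nu>)"
      by (rule integral_abs_bound)
    also have "\<dots> \<le> (\<integral>P. oscillation s P \<partial>splits \<nu>)"
      by (intro integral_mono integrable_abs Bochner_Integration.integrable_diff integrable_f_CT
            integrable_oscillation le_oscillation)
    finally show "\<bar>(\<integral>P. f (CT (graft s t) P) \<partial>splits \<nu>) - (\<integral>P. f (CT (graft s Lf) P) \<partial>splits \<nu>)\<bar>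
      \<le> (\<integral>P. oscillation s P \<partial>splits \<nu>)" .
  qed
  have "(\<integral>z. I z * oscillation (spine_prefix (fst z) h) (snd z) \<partial>decorated_spine) \<le>
      (\<integral>z. oscillation (spine_prefix (fst z) h) (snd z) \<partial>decorated_spine)"
    by (intro integral_mono int_I_osc int_osc mult_left_le_one_le oscillation_nonneg I01)
  then have E: "(\<Sum>s\<in>S. (4 / 27) ^ steps_size s * (\<integral>P. oscillation s P \<partial>splits \<nu>)) \<le> \<epsilon>"
    using h2 unfolding sum_osc by linarith
  have "\<bar>(\<integral>z. I z * f (truncation h z) \<partial>decorated_spine) - (\<integral>z. f (truncation h z) \<partial>decorated_spine)\<bar> \<le> B * \<delta>"
  proof -
    have "(\<integral>z. I z * f (truncation h z) \<partial>decorated_spine) - (\<integral>z. f (truncation h z) \<partial>decorated_spine) =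
        (\<integral>z. I z * f (truncation h z) - f (truncation h z) \<partial>decorated_spine)"
      by (rule Bochner_Integration.integral_diff[symmetric, OF int_I_trunc int_trunc])
    also have "\<bar>\<dots>\<bar> \<le> (\<integral>z. \<bar>I z * f (truncation h z) - f (truncation h z)\<bar> \<partial>decorated_spine)"
      by (rule integral_abs_bound)
    also have "\<dots> \<le> (\<integral>z. B * (1 - I z) \<partial>decorated_spine)"
    proof (intro integral_mono integrable_abs Bochner_Integration.integrable_diff int_I_trunc int_trunc)
      show "integrable decorated_spine (\<lambda>z. B * (1 - I z))" using intI by auto
      fix z
      have "\<bar>I z * f (truncation h z) - f (truncation h z)\<bar> = (1 - I z) * \<bar>f (truncation h z)\<bar>"
      proof -
        have "I z * f (truncation h z) - f (truncation h z) = - ((1 - I z) * f (truncation h z))"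
          by (simp add: algebra_simps)
        then show ?thesis using I01[of z] by (simp only: abs_minus_cancel abs_mult)
      qed
      also have "\<dots> \<le> (1 - I z) * B" using I01[of z] B by (intro mult_left_mono) auto
      finally show "\<bar>I z * f (truncation h z) - f (truncation h z)\<bar> \<le> B * (1 - I z)"
        by (simp add: mult.commute)
    qed
    also have "\<dots> = B * (1 - (\<Sum>s\<in>S. (4 / 27) ^ steps_size s))"
      using intI by (simp add: sumI Q.P.prob_space)
    also have "\<dots> \<le> B * \<delta>" using mass B0 by (intro mult_left_mono) auto
    finally show ?thesis .
  qed
  then have "\<bar>(\<Sum>s\<in>S. (4 / 27) ^ steps_size s * (\<integral>P. f (CT (graft s Lf) P) \<partial>splits \<nu>)) - ?L\<bar> \<le> \<epsilon>"
    using h1 B\<delta> unfolding sum_trunc by linarith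
  moreover have "1 - \<epsilon> \<le> (\<Sum>s\<in>S. (4 / 27) ^ steps_size s)" using mass \<delta>(2) by linarith
  ultimately show "\<exists>h S l e. finite S \<and> (\<forall>s\<in>S. length s = h) \<and>
      1 - \<epsilon> \<le> (\<Sum>s\<in>S. (4 / 27) ^ steps_size s) \<and>
      (\<forall>s\<in>S. \<forall>t. \<bar>(\<integral>P. f (CT (graft s t) P) \<partial>splits \<nu>) - l s\<bar> \<le> e s) \<and>
      (\<Sum>s\<in>S. (4 / 27) ^ steps_size s * e s) \<le> \<epsilon> \<and>
      \<bar>(\<Sum>s\<in>S. (4 / 27) ^ steps_size s * l s) - ?L\<bar> \<le> \<epsilon>"
    using S A E
    by (intro exI[of _ h] exI[of _ S] exI[of _ "\<lambda>s. \<integral>P. f (CT (graft s Lf) P) \<partial>splits \<nu>"]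
          exI[of _ "\<lambda>s. \<integral>P. oscillation s P \<partial>splits \<nu>"] conjI) auto
qed

end

section \<open>The triangulation law as an average over trees\<close>

lemma measurable_compact_triangulation:
  "(\<lambda>(t, P). compact_triangulation t P) \<in> borel_measurable
    (uniform_count_measure (ternary_trees n) \<Otimes>\<^sub>M splits \<nu>)"
proof -
  have fin: "finite (ternary_trees n)"
    using bij_betw_finite[OF bij_betw_enc[of n]] by simp
  have "(\<lambda>(t, P). compact_triangulation t P) \<in> borel_measurable (count_space (ternary_trees n) \<Otimes>\<^sub>M splits \<nu>)"
  proof (rule measurable_pair_measure_countable1)
    show "countable (ternary_trees n)" using fin by (rule countable_finite)
    fix T assume "T \<in> ternary_trees n"
    then obtain t where "T = enc t" using bij_betw_enc[of n] by (auto simp: bij_betw_def)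
    then show "(\<lambda>P. case (T, P) of (t, P) \<Rightarrow> compact_triangulation t P) \<in> borel_measurable (splits \<nu>)"
      using measurable_CT[of t] by simp
  qed
  moreover have "sets (uniform_count_measure (ternary_trees n) \<Otimes>\<^sub>M splits \<nu>) =
      sets (count_space (ternary_trees n) \<Otimes>\<^sub>M splits \<nu>)"
    by (intro sets_pair_measure_cong) (simp_all add: sets_uniform_count_measure)
  ultimately show ?thesis
    by (subst measurable_cong_sets[OF _ refl])
qed

lemma integral_triangulation_law:
  "(\<integral>K. f K \<partial>triangulation_law \<nu> n) =
    (\<Sum>t\<in>trees n. \<integral>P. f (CT t P) \<partial>splits \<nu>) / real (card (trees n))"
proof -
  let ?U = "uniform_count_measure (ternary_trees n)"
  have fin: "finite (ternary_trees n)"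
    using bij_betw_finite[OF bij_betw_enc[of n]] by simp
  have ne: "ternary_trees n \<noteq> {}"
    using bij_betw_enc[of n] trees_nonempty[of n] by (auto simp: bij_betw_def)
  interpret U: prob_space ?U by (rule prob_space_uniform_count_measure[OF fin ne])
  interpret US: pair_prob_space ?U "splits \<nu>" ..
  note m = measurable_compact_triangulation[of n]
  have fm: "(\<lambda>z. f (case z of (t, P) \<Rightarrow> compact_triangulation t P)) \<in> borel_measurable (?U \<Otimes>\<^sub>M splits \<nu>)"
    by (rule measurable_compose[OF m measurable_f])
  have int: "integrable (?U \<Otimes>\<^sub>M splits \<nu>) (\<lambda>z. f (case z of (t, P) \<Rightarrow> compact_triangulation t P))"
    by (rule US.P.integrable_const_bound[where B = B]) (use fm B in auto)
  have "(\<integral>K. f K \<partial>triangulation_law \<nu> n) =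
      (\<integral>z. f (case z of (t, P) \<Rightarrow> compact_triangulation t P) \<partial>(?U \<Otimes>\<^sub>M splits \<nu>))"
    unfolding triangulation_law_def by (rule integral_distr[OF m measurable_f])
  also have "\<dots> = (\<integral>T. \<integral>P. f (compact_triangulation T P) \<partial>splits \<nu> \<partial>?U)"
    using US.integral_fst'[OF int] by simp
  also have "\<dots> = (\<Sum>T\<in>ternary_trees n. \<integral>P. f (compact_triangulation T P) \<partial>splits \<nu>) / real (card (ternary_trees n))"
    by (rule integral_uniform_count_measure[OF fin])
  also have "(\<Sum>T\<in>ternary_trees n. \<integral>P. f (compact_triangulation T P) \<partial>splits \<nu>) =
      (\<Sum>t\<in>trees n. \<integral>P. f (CT t P) \<partial>splits \<nu>)"
    by (rule sum.reindex_bij_betw[OF bij_betw_enc, symmetric])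
  also have "card (ternary_trees n) = card (trees n)"
    by (rule bij_betw_same_card[OF bij_betw_enc, symmetric])
  finally show ?thesis .
qed

end

end

theorem theorem3p9:
  fixes \<nu> :: "(real ^ 3) measure"
    and \<Omega> :: "nat \<Rightarrow> 'a measure"
    and m :: "nat \<Rightarrow> 'a \<Rightarrow> triangle_compact"
  assumes "splitting_law \<nu>"
    and "\<And>n. prob_space (\<Omega> n)"
    and "\<And>n. m n \<in> \<Omega> n \<rightarrow>\<^sub>M borel"
    and "\<And>n. distr (\<Omega> n) borel (m n) = triangulation_law \<nu> n"
  shows "\<exists>(\<Omega>_inf :: triangle_compact measure) (m_inf :: triangle_compact \<Rightarrow> triangle_compact).
    prob_space \<Omega>_inf \<and> m_inf \<in> \<Omega>_inf \<rightarrow>\<^sub>M borel \<and>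
    converges_in_distribution \<Omega> m \<Omega>_inf m_inf"
proof -
  interpret splitting \<nu> by standard (rule assms(1))
  obtain X where X: "X \<in> borel_measurable decorated_spine"
    and lim: "AE z in decorated_spine. (\<forall>u. snd z u \<in> open_simplex) \<and> (\<lambda>h. tip_perimeter h z) \<longlonglongrightarrow> 0 \<and>
      (\<forall>h. dist (X z) (truncation h z) \<le> tip_perimeter h z)"
    using limit_exists by blast
  \<comment> \<open>The limit is to be realised over \<open>triangle_compact\<close> itself, so the
    law of \<open>X\<close> is transported there and the identity taken as the random set.\<close>
  let ?N = "distr decorated_spine borel X"
  have "converges_in_distribution \<Omega> m ?N (\<lambda>K. K)"
    unfolding converges_in_distribution_def
  proof (intro allI impI, elim conjE)
    fix f :: "triangle_compact \<Rightarrow> real"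
    assume f: "continuous_on UNIV f" and "bounded (range f)"
    then obtain B where B: "\<And>K. \<bar>f K\<bar> \<le> B" by (auto simp: bounded_iff)
    have fm: "f \<in> borel_measurable borel" by (rule measurable_f[OF f B])
    have "(\<integral>\<omega>. f (m n \<omega>) \<partial>\<Omega> n) = (\<Sum>t\<in>trees n. \<integral>P. f (CT t P) \<partial>splits \<nu>) / real (card (trees n))" for n
      using integral_distr[OF assms(3) fm, of n] integral_triangulation_law[OF f B, of n]
      by (simp add: assms(4))
    moreover have "(\<integral>K. f K \<partial>?N) = (\<integral>z. f (X z) \<partial>decorated_spine)"
      by (rule integral_distr[OF X fm])
    ultimately show "(\<lambda>n. \<integral>\<omega>. f (m n \<omega>) \<partial>\<Omega> n) \<longlonglongrightarrow> (\<integral>K. f K \<partial>?N)"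
      using uniform_expectation_tendsto[OF f B X lim] by simp
  qed
  moreover have "prob_space ?N" by (rule Q.P.prob_space_distr[OF X])
  ultimately show ?thesis
    by (intro exI[of _ ?N] exI[of _ "\<lambda>K. K"]) simp
qed

end
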